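(* Let $(G,p)$ be a well-positioned bar-joint framework in the cylindrical normed space $(\mathbb{R}^3,\|\cdot\|_{\mathrm{cyl}})$. The following statements are equivalent. (i) $(G,p)$ is minimally infinitesimally rigid in $(\mathbb{R}^3,\|\cdot\|_{\mathrm{cyl}})$. (ii) The projected monochrome subframeworks $(G_1,p_1)$ and $(G_2,p_2)$ are minimally infinitesimally rigid in the Euclidean plane and the real line respectively. (iii) The monochrome subgraphs $G_1$ and $G_2$ are respectively a Laman graph and a tree, and $p_1$ is a regular placement of $G_1$ in the Euclidean plane.
   Context: $\|(x,y,z)\|_{\mathrm{cyl}}=\max\{\sqrt{x^2+y^2},|z|\}$ on $\mathbb{R}^3=X_1\times X_2$, with $X_1=\mathbb{R}^2$ (Euclidean norm, written $\|\cdot\|_1$ below) and $X_2=\mathbb{R}$ (absolute value, written $\|\cdot\|_2$ below); $P_1(x,y,z)=(x,y)$, $P_2(x,y,z)=z$. Frameworks. $G=(V,E)$ is a finite simple graph. A bar-joint framework $(G,p)$ in a finite-dimensional real normed space $X$ is $G$ with a map (placement) $p:V\to X$, $v\mapsto p_v$, such that $p_v\ne p_w$ for all $vw\in E$. A support functional for a unit vector $x_0\in X$ is a linear functional $f:X\to\mathbb{R}$ with $\|f\|\le1$ and $f(x_0)=1$; the norm is smooth at $x\neq0$ if $x/\|x\|$ has exactly one support functional. $(G,p)$ is well-positioned if the norm is smooth at $p_v-p_w$ for every $vw\in E$. A rigid motion of $(X,\|\cdot\|)$ is a family of continuous paths $\{\alpha_x:[-1,1]\to X\}_{x\in X}$ with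 $\alpha_x(0)=x$, $\alpha_x$ differentiable at $0$, and $\|\alpha_x(t)-\alpha_y(t)\|=\|x-y\|$ for all $x,y\in X$, $t\in[-1,1]$. $\mathcal{T}(X,\|\cdot\|)$ is the space of maps $\eta:X\to X$ of the form $\eta(x)=\alpha_x'(0)$ for a rigid motion $\alpha$. With $f_G:X^V\to\mathbb{R}^E$, $f_G((x_v)_v)=(\|x_v-x_w\|)_{vw\in E}$, an infinitesimal flex of $(G,p)$ is $z\in X^V$ with $\lim_{t\to0}\frac1t(f_G(p+tz)-f_G(p))=0$; it is trivial if $z=\eta\circ p$ for some $\eta\in\mathcal{T}(X,\|\cdot\|)$. $(G,p)$ is infinitesimally rigid if every infinitesimal flex is trivial, infinitesimally flexible otherwise, and minimally infinitesimally rigid if it is infinitesimally rigid and every subframework obtained by removing an edge from $G$ (keeping all vertices) is infinitesimally flexible. Framework colours. An edge $vw$ has framework colour $j\in\{1,2\}$ if $\|p_v-p_w\|_{\mathrm{cyl}}=\|P_j(p_v-p_w)\|_j$; $E_j$ is the set of edges with colour $j$, $G_j=(V,E_j)$ is the monochrome subgraph (on the full vertex set $V$), $p_j=P_j\circ p$, and $(G_j,p_j)$ is the projected monochrome subframework, a bar-joint framework in $X_j$. A Laman graph is a $(2,3)$-tight graph, i.e. a graph $(V,E)$ with $|E|=2|V|-3$ such that every subgraph $H$ with $|V(H)|\ge2$ has at most $2|V(H)|-3$ edges. A placement $q$ of a graph $H$ in the Euclidean plane is regular if the rank of the differential $df_H$ at $q$ is maximal among the ranks of $df_H(x)$ over all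 well-positioned placements $x$ of $H$ in the Euclidean plane (every placement, i.e. every $x$ with $x_v\ne x_w$ for each edge $vw$, is well-positioned there).
   Formalization: The equivalence with (iii) is stated for graphs with at least two vertices, and the graph is nonempty: on one vertex (or none) (i) and (ii) hold, but |E| = 0 differs from 2|V|-3, so G_1 is not a Laman graph and (iii) fails. *)

theory Defs
  imports "HOL-Analysis.Analysis"
begin

text \<open>
  Normed spaces are given by an explicit norm \<open>N\<close> on a Euclidean space \<open>'a\<close>. Limits, continuity
  and derivatives refer to the standard topology of \<open>'a\<close>; since \<open>'a\<close> is finite-dimensional, this
  is also the topology induced by \<open>N\<close>.

  Frameworks live on the vertex set \<open>UNIV :: 'v set\<close> for a finite type \<open>'v\<close>, so that \<open>X\<^sup>V\<close> is the
  Euclidean space \<open>'a ^ 'v\<close>. Edges are two-element sets of vertices.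
\<close>

section \<open>Graphs\<close>

definition simple_graph :: "'v set \<Rightarrow> 'v set set \<Rightarrow> bool" where
  "simple_graph V E \<longleftrightarrow> finite V \<and> (\<forall>e\<in>E. e \<subseteq> V \<and> card e = 2)"

definition subgraph :: "'v set \<Rightarrow> 'v set set \<Rightarrow> 'v set \<Rightarrow> 'v set set \<Rightarrow> bool" where
  "subgraph W F V E \<longleftrightarrow> simple_graph W F \<and> W \<subseteq> V \<and> F \<subseteq> E"

text \<open>The counts are taken in \<open>int\<close>, so \<open>2|V| - 3\<close> is not truncated at zero.\<close>

definition laman_graph :: "'v set \<Rightarrow> 'v set set \<Rightarrow> bool" where
  "laman_graph V E \<longleftrightarrow> simple_graph V E \<and> int (card E) = 2 * int (card V) - 3 \<and>
     (\<forall>W F. subgraph W F V E \<and> card W \<ge> 2 \<longrightarrow> int (card F) \<le> 2 * int (card W) - 3)"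

definition connected_graph :: "'v set \<Rightarrow> 'v set set \<Rightarrow> bool" where
  "connected_graph V E \<longleftrightarrow> V \<noteq> {} \<and> (\<forall>u\<in>V. \<forall>v\<in>V. (u, v) \<in> {(a, b). {a, b} \<in> E}\<^sup>*)"

definition is_cycle :: "'v set set \<Rightarrow> 'v list \<Rightarrow> bool" where
  "is_cycle E c \<longleftrightarrow> length c \<ge> 3 \<and> distinct c \<and>
     (\<forall>i<length c. {c ! i, c ! (Suc i mod length c)} \<in> E)"

definition tree_graph :: "'v set \<Rightarrow> 'v set set \<Rightarrow> bool" where
  "tree_graph V E \<longleftrightarrow> simple_graph V E \<and> connected_graph V E \<and> (\<nexists>c. is_cycle E c)"

section \<open>Smoothness of a norm\<close>

definition dual_norm :: "('a::euclidean_space \<Rightarrow> real) \<Rightarrow> ('a \<Rightarrow> real) \<Rightarrow> real" where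
  "dual_norm N f = (SUP x\<in>{x. N x \<le> 1}. \<bar>f x\<bar>)"

definition support_functional :: "('a::euclidean_space \<Rightarrow> real) \<Rightarrow> 'a \<Rightarrow> ('a \<Rightarrow> real) \<Rightarrow> bool" where
  "support_functional N x\<^sub>0 f \<longleftrightarrow> linear f \<and> dual_norm N f \<le> 1 \<and> f x\<^sub>0 = 1"

definition smooth_at :: "('a::euclidean_space \<Rightarrow> real) \<Rightarrow> 'a \<Rightarrow> bool" where
  "smooth_at N x \<longleftrightarrow> x \<noteq> 0 \<and> (\<exists>!f. support_functional N (x /\<^sub>R N x) f)"

section \<open>Bar-joint frameworks\<close>

definition bar_joint_framework :: "'v::finite set set \<Rightarrow> ('a::euclidean_space) ^ 'v \<Rightarrow> bool" where
  "bar_joint_framework E p \<longleftrightarrow>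
     simple_graph UNIV E \<and> (\<forall>v w. {v, w} \<in> E \<longrightarrow> p $ v \<noteq> p $ w)"

definition well_positioned ::
    "('a::euclidean_space \<Rightarrow> real) \<Rightarrow> 'v::finite set set \<Rightarrow> 'a ^ 'v \<Rightarrow> bool" where
  "well_positioned N E p \<longleftrightarrow>
     bar_joint_framework E p \<and> (\<forall>v w. {v, w} \<in> E \<longrightarrow> smooth_at N (p $ v - p $ w))"

definition rigid_motion :: "('a::euclidean_space \<Rightarrow> real) \<Rightarrow> ('a \<Rightarrow> real \<Rightarrow> 'a) \<Rightarrow> bool" where
  "rigid_motion N \<alpha> \<longleftrightarrow>
     (\<forall>x. continuous_on {-1..1} (\<alpha> x) \<and> \<alpha> x 0 = x \<and> \<alpha> x differentiable (at 0)) \<and>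
     (\<forall>x y. \<forall>t\<in>{-1..1}. N (\<alpha> x t - \<alpha> y t) = N (x - y))"

definition infinitesimal_rigid_motions :: "('a::euclidean_space \<Rightarrow> real) \<Rightarrow> ('a \<Rightarrow> 'a) set" where
  "infinitesimal_rigid_motions N =
     {\<lambda>x. vector_derivative (\<alpha> x) (at 0) | \<alpha>. rigid_motion N \<alpha>}"

text \<open>The common value of \<open>N (x\<^sub>v - x\<^sub>w)\<close> and \<open>N (x\<^sub>w - x\<^sub>v)\<close> for \<open>e = {v, w}\<close>.\<close>

definition edge_length ::
    "('a::euclidean_space \<Rightarrow> real) \<Rightarrow> 'a ^ 'v \<Rightarrow> 'v::finite set \<Rightarrow> real" where
  "edge_length N x e = (THE r. \<forall>v w. e = {v, w} \<longrightarrow> r = N (x $ v - x $ w))"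

lemma edge_length_insert:
  assumes "\<And>a. N (- a) = N a"
  shows "edge_length N x {v, w} = N (x $ v - x $ w)"
proof -
  have "N (x $ w - x $ v) = N (x $ v - x $ w)"
    using assms[of "x $ v - x $ w"] by simp
  then show ?thesis
    unfolding edge_length_def by (intro the_equality) (auto simp: doubleton_eq_iff)
qed

text \<open>\<open>\<real>\<^sup>E\<close> is realised as the subspace of \<open>real ^ 'v set\<close> of vectors vanishing outside \<open>E\<close>.\<close>

definition rigidity_map ::
    "('a::euclidean_space \<Rightarrow> real) \<Rightarrow> 'v::finite set set \<Rightarrow> 'a ^ 'v \<Rightarrow> real ^ 'v set" where
  "rigidity_map N E x = (\<chi> e. if e \<in> E then edge_length N x e else 0)"

definition infinitesimal_flex ::
    "('a::euclidean_space \<Rightarrow> real) \<Rightarrow> 'v::finite set set \<Rightarrow> 'a ^ 'v \<Rightarrow> 'a ^ 'v \<Rightarrow> bool" where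
  "infinitesimal_flex N E p z \<longleftrightarrow>
     ((\<lambda>t. (1 / t) *\<^sub>R (rigidity_map N E (p + t *\<^sub>R z) - rigidity_map N E p)) \<longlongrightarrow> 0) (at 0)"

definition trivial_flex ::
    "('a::euclidean_space \<Rightarrow> real) \<Rightarrow> 'a ^ 'v \<Rightarrow> 'a ^ 'v::finite \<Rightarrow> bool" where
  "trivial_flex N p z \<longleftrightarrow> (\<exists>\<eta>\<in>infinitesimal_rigid_motions N. z = (\<chi> v. \<eta> (p $ v)))"

definition infinitesimally_rigid ::
    "('a::euclidean_space \<Rightarrow> real) \<Rightarrow> 'v::finite set set \<Rightarrow> 'a ^ 'v \<Rightarrow> bool" where
  "infinitesimally_rigid N E p \<longleftrightarrow> (\<forall>z. infinitesimal_flex N E p z \<longrightarrow> trivial_flex N p z)"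

definition minimally_infinitesimally_rigid ::
    "('a::euclidean_space \<Rightarrow> real) \<Rightarrow> 'v::finite set set \<Rightarrow> 'a ^ 'v \<Rightarrow> bool" where
  "minimally_infinitesimally_rigid N E p \<longleftrightarrow>
     infinitesimally_rigid N E p \<and> (\<forall>e\<in>E. \<not> infinitesimally_rigid N (E - {e}) p)"

definition rigidity_rank ::
    "('a::euclidean_space \<Rightarrow> real) \<Rightarrow> 'v::finite set set \<Rightarrow> 'a ^ 'v \<Rightarrow> nat" where
  "rigidity_rank N E x = dim (range (frechet_derivative (rigidity_map N E) (at x)))"

definition regular_placement ::
    "('a::euclidean_space \<Rightarrow> real) \<Rightarrow> 'v::finite set set \<Rightarrow> 'a ^ 'v \<Rightarrow> bool" where
  "regular_placement N E q \<longleftrightarrow> well_positioned N E q \<and>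
     (\<forall>x. well_positioned N E x \<longrightarrow> rigidity_rank N E x \<le> rigidity_rank N E q)"

section \<open>The cylindrical norm\<close>

text \<open>
  \<open>\<real>\<^sup>3\<close> is written as \<open>X\<^sub>1 \<times> X\<^sub>2\<close> with \<open>X\<^sub>1 = real ^ 2\<close> and \<open>X\<^sub>2 = real\<close>, so the projections \<open>P\<^sub>1\<close> and
  \<open>P\<^sub>2\<close> are \<open>fst\<close> and \<open>snd\<close>. The type class norm of the product is not used.
\<close>

definition cyl_norm :: "(real ^ 2) \<times> real \<Rightarrow> real" where
  "cyl_norm x = max (norm (fst x)) \<bar>snd x\<bar>"

text \<open>
  The edges on which the cylindrical norm is attained by the projection \<open>P\<close>, i.e. the edges of
  colour 1 for \<open>P = fst\<close> and of colour 2 for \<open>P = snd\<close>. For a framework that is not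
  well-positioned an edge may have both colours.
\<close>

definition monochrome_edges ::
    "((real ^ 2) \<times> real \<Rightarrow> 'b::real_normed_vector) \<Rightarrow> 'v::finite set set \<Rightarrow>
      ((real ^ 2) \<times> real) ^ 'v \<Rightarrow> 'v set set" where
  "monochrome_edges P E p =
     {{v, w} | v w. {v, w} \<in> E \<and> cyl_norm (p $ v - p $ w) = norm (P (p $ v - p $ w))}"

definition projected_placement :: "('a \<Rightarrow> 'b) \<Rightarrow> 'a ^ 'v::finite \<Rightarrow> 'b ^ 'v" where
  "projected_placement P p = (\<chi> v. P (p $ v))"

end

theory Submission
  imports Defs
begin

text \<open>
  The cylindrical norm is the maximum of the two norms \<open>norm (fst x)\<close> and \<open>\<bar>snd x\<bar>\<close>, and it is
  smooth exactly away from the cone where the two agree. In a well-positioned framework every edge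
  therefore has exactly one colour, and close to the given placement its cylindrical length is the
  length of its projection of that colour. So a velocity \<open>z\<close> is an infinitesimal flex of \<open>(G, p)\<close>
  precisely when \<open>fst z\<close> is a flex of \<open>(G\<^sub>1, p\<^sub>1)\<close> and \<open>snd z\<close> is a flex of \<open>(G\<^sub>2, p\<^sub>2)\<close>.

  The trivial flexes split in the same way. A velocity field of a rigid motion of the cylindrical
  space satisfies the orthogonality condition of the plane along all directions of colour 1 and that
  of the line along all directions of colour 2. Comparing two points with a third one that is far
  away in a suitable direction shows that the vertical velocity is constant and that the horizontal
  velocity depends on the horizontal position only; the latter is then \<open>s *\<^sub>R rot90 x + c\<close> by
  linear algebra, as for the Euclidean plane. Hence rigidity, and since each edge
  has a single colour also minimal rigidity, is equivalent to the conjunction of the corresponding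
  properties of the two projected frameworks (\<open>minimally_infinitesimally_rigid_cyl_norm_iff\<close>).

  On the line a flex is a function that is constant along edges, so rigidity is connectedness and
  minimal rigidity is being a tree (\<open>minimally_infinitesimally_rigid_line_iff_tree\<close>).

  In the plane the flexes form the orthogonal complement of the rows of the rigidity matrix, and the
  trivial flexes form a space of dimension 3 as soon as there is an edge. On at least
  two vertices, minimal rigidity therefore says that the rows are linearly independent and that there are \<open>2|V| - 3\<close> of them. Applying the same
  dimension count to the subframework on a vertex set \<open>W\<close> gives the Laman condition, and a placement
  whose rank equals the number of edges is regular. For the converse, regularity transports
  independence from any one placement of \<open>G\<^sub>1\<close> to \<open>p\<^sub>1\<close>, so what is needed is Laman's theorem: every
  sparse graph has some placement with independent rows (\<open>laman_sparse_imp_stress_free\<close>). It is proved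
  by induction. A sparse graph has a vertex of degree at most 3; removing it, and adding a suitable
  edge between two of its neighbours if the degree is 3, leaves a sparse graph. An independent
  placement of the smaller graph stays independent after a small perturbation into general position,
  and the removed vertex can then be put back (\<open>stress_free_zero_extension\<close>,
  \<open>stress_free_one_extension\<close>).
\<close>

section \<open>Smoothness of the norms\<close>

text \<open>
  A functional \<open>a \<bullet> _\<close> has dual norm \<open>norm a\<close>, so the equality case of the Cauchy-Schwarz inequality
  forces \<open>a = u\<close>. The Euclidean norm is thus smooth at every non-zero point.
\<close>

lemma support_functional_norm_iff:
  fixes u :: "'a::euclidean_space"
  assumes u: "norm u = 1"
  shows "support_functional norm u f \<longleftrightarrow> f = (\<lambda>x. u \<bullet> x)"
proof
  assume sf: "support_functional norm u f"
  then have lin: "linear f" and dn: "dual_norm norm f \<le> 1" and fu: "f u = 1"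
    by (auto simp: support_functional_def)
  define a where "a = adjoint f 1"
  have f: "f x = a \<bullet> x" for x
    using adjoint_works[OF lin, of x 1] by (simp add: a_def inner_commute)
  have "norm a \<le> 1"
  proof (cases "a = 0")
    case False
    have bdd: "bdd_above ((\<lambda>x. \<bar>f x\<bar>) ` {x. norm x \<le> 1})"
    proof (rule bdd_aboveI2)
      fix x :: 'a assume "x \<in> {x. norm x \<le> 1}"
      then have "norm a * norm x \<le> norm a * 1"
        by (intro mult_left_mono) auto
      with Cauchy_Schwarz_ineq2[of a x] show "\<bar>f x\<bar> \<le> norm a"
        by (simp add: f)
    qed
    have "\<bar>f (a /\<^sub>R norm a)\<bar> \<le> dual_norm norm f"
      unfolding dual_norm_def by (rule cSUP_upper[OF _ bdd]) (use False in auto)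
    moreover have "f (a /\<^sub>R norm a) = norm a"
      using False by (simp add: f dot_square_norm power2_eq_square)
    ultimately show ?thesis
      using dn by simp
  qed simp
  then have "(norm a)\<^sup>2 \<le> 1"
    by (simp add: power_le_one)
  have "(norm (a - u))\<^sup>2 = (norm a)\<^sup>2 - 2 * f u + (norm u)\<^sup>2"
    by (simp add: power2_norm_eq_inner inner_diff f inner_commute algebra_simps)
  also have "\<dots> \<le> 0"
    using \<open>(norm a)\<^sup>2 \<le> 1\<close> fu u by simp
  finally have "a = u"
    by simp
  then show "f = (\<lambda>x. u \<bullet> x)"
    using f by auto
next
  assume f: "f = (\<lambda>x. u \<bullet> x)"
  have "dual_norm norm f \<le> 1"
    unfolding dual_norm_def
  proof (rule cSUP_least)
    show "{x::'a. norm x \<le> 1} \<noteq> {}"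
      using norm_zero by (metis (mono_tags) empty_iff mem_Collect_eq zero_le_one)
    fix x :: 'a assume "x \<in> {x. norm x \<le> 1}"
    then show "\<bar>f x\<bar> \<le> 1"
      using Cauchy_Schwarz_ineq2[of u x] u by (simp add: f)
  qed
  moreover have "linear f"
    unfolding f by (simp add: bounded_linear.linear bounded_linear_inner_right)
  ultimately show "support_functional norm u f"
    using u by (simp add: support_functional_def f dot_square_norm)
qed

lemma smooth_at_norm_iff: "smooth_at norm x \<longleftrightarrow> x \<noteq> 0"
  for x :: "'a::euclidean_space"
  by (cases "x = 0") (simp_all add: smooth_at_def support_functional_norm_iff)

lemma well_positioned_norm_iff:
  "well_positioned norm E p \<longleftrightarrow> bar_joint_framework E p"
  by (auto simp: well_positioned_def bar_joint_framework_def smooth_at_norm_iff)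

text \<open>
  On the cone where both norms agree, the support functionals of the two factors both support the
  cylindrical norm, and they differ.
\<close>

lemma smooth_at_cyl_norm_imp:
  assumes "smooth_at cyl_norm d"
  shows "norm (fst d) \<noteq> \<bar>snd d\<bar>"
proof
  assume eq: "norm (fst d) = \<bar>snd d\<bar>"
  define u where "u = d /\<^sub>R cyl_norm d"
  have "d \<noteq> 0" using assms by (simp add: smooth_at_def)
  with eq have r: "cyl_norm d = norm (fst d)" "\<bar>snd d\<bar> > 0" "norm (fst d) > 0"
    by (auto simp: cyl_norm_def prod_eq_iff)
  have u1: "norm (fst u) = 1" and u2: "\<bar>snd u\<bar> = 1"
    using r eq by (auto simp: u_def abs_mult)
  have u2': "snd u * snd u = 1"
    using u2 by (metis abs_mult_self_eq mult_1)
  have ne: "{x. cyl_norm x \<le> 1} \<noteq> {}"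
    by (auto simp: cyl_norm_def intro!: exI[of _ 0])
  have "support_functional cyl_norm u (\<lambda>x. fst u \<bullet> fst x)"
    unfolding support_functional_def dual_norm_def
  proof (intro conjI cSUP_least ne)
    show "linear (\<lambda>x. fst u \<bullet> fst x)"
      by (rule linearI) (simp_all add: inner_add_right)
    show "fst u \<bullet> fst u = 1" using u1 by (simp add: dot_square_norm)
    fix x :: "(real ^ 2) \<times> real" assume "x \<in> {x. cyl_norm x \<le> 1}"
    then show "\<bar>fst u \<bullet> fst x\<bar> \<le> 1"
      using Cauchy_Schwarz_ineq2[of "fst u" "fst x"] u1 by (simp add: cyl_norm_def)
  qed
  moreover have "support_functional cyl_norm u (\<lambda>x. snd u * snd x)"
    unfolding support_functional_def dual_norm_def
  proof (intro conjI cSUP_least ne)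
    show "linear (\<lambda>x. snd u * snd x)"
      by (rule linearI) (simp_all add: algebra_simps)
    show "snd u * snd u = 1" by fact
    fix x :: "(real ^ 2) \<times> real" assume "x \<in> {x. cyl_norm x \<le> 1}"
    then show "\<bar>snd u * snd x\<bar> \<le> 1"
      using u2 by (simp add: cyl_norm_def abs_mult)
  qed
  moreover have "(\<lambda>x. fst u \<bullet> fst x) \<noteq> (\<lambda>x. snd u * snd x)"
  proof
    assume "(\<lambda>x. fst u \<bullet> fst x) = (\<lambda>x. snd u * snd x)"
    from fun_cong[OF this, of "(0, snd u)"] u2' show False by simp
  qed
  ultimately show False
    using assms unfolding smooth_at_def u_def by blast
qed

section \<open>Monochrome subframeworks\<close>

lemma simple_graph_subset: "simple_graph V E \<Longrightarrow> F \<subseteq> E \<Longrightarrow> simple_graph V F"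
  by (auto simp: simple_graph_def)

lemma simple_graph_edgeE:
  assumes "simple_graph V E" "e \<in> E"
  obtains v w where "e = {v, w}" "v \<noteq> w"
  using assms by (auto simp: simple_graph_def card_2_iff)

lemma bar_joint_framework_subset:
  "bar_joint_framework E p \<Longrightarrow> F \<subseteq> E \<Longrightarrow> bar_joint_framework F p"
  by (auto simp: bar_joint_framework_def intro: simple_graph_subset)

lemma well_positioned_subset:
  "well_positioned N E p \<Longrightarrow> F \<subseteq> E \<Longrightarrow> well_positioned N F p"
  by (auto simp: well_positioned_def intro: bar_joint_framework_subset)

lemma cyl_norm_minus [simp]: "cyl_norm (- x) = cyl_norm x"
  by (simp add: cyl_norm_def)

lemma well_positioned_cyl_norm_neq:
  "well_positioned cyl_norm E p \<Longrightarrow> {v, w} \<in> E \<Longrightarrow>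
    norm (fst (p $ v - p $ w)) \<noteq> \<bar>snd (p $ v - p $ w)\<bar>"
  unfolding well_positioned_def using smooth_at_cyl_norm_imp by blast

lemma monochrome_edges_fst_iff:
  assumes "well_positioned cyl_norm E p"
  shows "{v, w} \<in> monochrome_edges fst E p \<longleftrightarrow>
    {v, w} \<in> E \<and> \<bar>snd (p $ v - p $ w)\<bar> < norm (fst (p $ v - p $ w))" (is "?l \<longleftrightarrow> ?r")
proof
  assume ?l
  then obtain v' w' where *: "{v, w} = {v', w'}" "{v', w'} \<in> E"
      "cyl_norm (p $ v' - p $ w') = norm (fst (p $ v' - p $ w'))"
    by (auto simp: monochrome_edges_def)
  then have "\<bar>snd (p $ v' - p $ w')\<bar> < norm (fst (p $ v' - p $ w'))"
    using well_positioned_cyl_norm_neq[OF assms *(2)] by (auto simp: cyl_norm_def)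
  then show ?r
    using *(1,2)
    by (auto simp: doubleton_eq_iff norm_minus_commute abs_minus_commute insert_commute)
next
  assume ?r
  then show ?l
    unfolding monochrome_edges_def
    by (force simp: cyl_norm_def)
qed

lemma monochrome_edges_snd_iff:
  assumes "well_positioned cyl_norm E p"
  shows "{v, w} \<in> monochrome_edges snd E p \<longleftrightarrow>
    {v, w} \<in> E \<and> norm (fst (p $ v - p $ w)) < \<bar>snd (p $ v - p $ w)\<bar>" (is "?l \<longleftrightarrow> ?r")
proof
  assume ?l
  then obtain v' w' where *: "{v, w} = {v', w'}" "{v', w'} \<in> E"
      "cyl_norm (p $ v' - p $ w') = norm (snd (p $ v' - p $ w'))"
    by (auto simp: monochrome_edges_def)
  then have "norm (fst (p $ v' - p $ w')) < \<bar>snd (p $ v' - p $ w')\<bar>"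
    using well_positioned_cyl_norm_neq[OF assms *(2)] by (auto simp: cyl_norm_def)
  then show ?r
    using *(1,2)
    by (auto simp: doubleton_eq_iff norm_minus_commute abs_minus_commute insert_commute)
next
  assume ?r
  then show ?l
    unfolding monochrome_edges_def
    by (force simp: cyl_norm_def)
qed

lemma monochrome_edges_partition:
  assumes "well_positioned cyl_norm E p"
  shows "monochrome_edges fst E p \<union> monochrome_edges snd E p = E"
    and "monochrome_edges fst E p \<inter> monochrome_edges snd E p = {}"
proof -
  have sg: "simple_graph UNIV E"
    using assms by (simp add: well_positioned_def bar_joint_framework_def)
  have sub: "monochrome_edges P E p \<subseteq> E" for P :: "(real ^ 2) \<times> real \<Rightarrow> 'b::real_normed_vector"
    by (auto simp: monochrome_edges_def)
  have "e \<in> monochrome_edges fst E p \<longleftrightarrow> e \<notin> monochrome_edges snd E p" if e: "e \<in> E" for e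
  proof -
    from sg e obtain v w where "e = {v, w}"
      by (rule simple_graph_edgeE)
    then show ?thesis
      using e well_positioned_cyl_norm_neq[OF assms, of v w]
      by (auto simp: monochrome_edges_fst_iff[OF assms] monochrome_edges_snd_iff[OF assms])
  qed
  then show "monochrome_edges fst E p \<union> monochrome_edges snd E p = E"
    and "monochrome_edges fst E p \<inter> monochrome_edges snd E p = {}"
    using sub[of fst] sub[of snd] by blast+
qed

lemma monochrome_edges_diff:
  "monochrome_edges P (E - {e}) p = monochrome_edges P E p - {e}"
  by (auto simp: monochrome_edges_def)

lemma bar_joint_framework_projected:
  assumes "well_positioned cyl_norm E p"
  shows "bar_joint_framework (monochrome_edges fst E p) (projected_placement fst p)"
    and "bar_joint_framework (monochrome_edges snd E p) (projected_placement snd p)"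
proof -
  have sg: "simple_graph UNIV E"
    using assms by (simp add: well_positioned_def bar_joint_framework_def)
  show "bar_joint_framework (monochrome_edges fst E p) (projected_placement fst p)"
    unfolding bar_joint_framework_def
    using simple_graph_subset[OF sg] monochrome_edges_partition(1)[OF assms]
      monochrome_edges_fst_iff[OF assms]
    by (auto simp: projected_placement_def)
  show "bar_joint_framework (monochrome_edges snd E p) (projected_placement snd p)"
    unfolding bar_joint_framework_def
    using simple_graph_subset[OF sg] monochrome_edges_partition(1)[OF assms]
      monochrome_edges_snd_iff[OF assms]
    by (auto simp: projected_placement_def)
qed

section \<open>Flexes as orthogonality conditions\<close>

text \<open>
  The condition for being a flex, read off at a single coordinate of the rigidity map. The later
  arguments treat edges of different colours separately.
\<close>

definition edge_flex ::
    "('a::euclidean_space \<Rightarrow> real) \<Rightarrow> 'a ^ 'v \<Rightarrow> 'a ^ 'v \<Rightarrow> 'v::finite set \<Rightarrow> bool" where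
  "edge_flex N p z e \<longleftrightarrow>
     ((\<lambda>t. (edge_length N (p + t *\<^sub>R z) e - edge_length N p e) / t) \<longlongrightarrow> 0) (at 0)"

lemma infinitesimal_flex_iff_edge_flex:
  "infinitesimal_flex N E p z \<longleftrightarrow> (\<forall>e\<in>E. edge_flex N p z e)"
proof -
  let ?f = "\<lambda>t. (1 / t) *\<^sub>R (rigidity_map N E (p + t *\<^sub>R z) - rigidity_map N E p)"
  have comp: "((\<lambda>t. ?f t $ e) \<longlongrightarrow> 0) (at 0) \<longleftrightarrow> (e \<in> E \<longrightarrow> edge_flex N p z e)" for e
    by (simp add: rigidity_map_def edge_flex_def)
  have "infinitesimal_flex N E p z \<longleftrightarrow> (\<forall>e. ((\<lambda>t. ?f t $ e) \<longlongrightarrow> 0) (at 0))"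
    unfolding infinitesimal_flex_def
    using tendsto_vec_nth[of ?f 0 "at 0"] vec_tendstoI[of ?f 0 "at 0"] by auto
  then show ?thesis
    unfolding comp by blast
qed

text \<open>
  The difference quotient of an edge length converges to the derivative \<open>D\<close>, so it converges to zero
  only if \<open>D\<close> vanishes.
\<close>

lemma edge_flex_iff_derivative:
  assumes sym: "\<And>a. N (- a) = N a"
    and D: "((\<lambda>t. N (p $ v - p $ w + t *\<^sub>R (z $ v - z $ w))) has_real_derivative D) (at 0)"
  shows "edge_flex N p z {v, w} \<longleftrightarrow> D = 0"
proof -
  have eq: "(\<lambda>t. (edge_length N (p + t *\<^sub>R z) {v, w} - edge_length N p {v, w}) / t) =
    (\<lambda>t. (N (p $ v - p $ w + (0 + t) *\<^sub>R (z $ v - z $ w)) -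
          N (p $ v - p $ w + 0 *\<^sub>R (z $ v - z $ w))) / t)"
    by (simp add: edge_length_insert[of N, OF sym] algebra_simps)
  have lim: "((\<lambda>t. (N (p $ v - p $ w + (0 + t) *\<^sub>R (z $ v - z $ w)) -
          N (p $ v - p $ w + 0 *\<^sub>R (z $ v - z $ w))) / t) \<longlongrightarrow> D) (at 0)"
    using D unfolding DERIV_def .
  show ?thesis
    unfolding edge_flex_def eq
    using lim LIM_unique by fast
qed

lemma has_real_derivative_norm_line:
  fixes d z :: "'a::real_inner"
  assumes "d \<noteq> 0"
  shows "((\<lambda>t. norm (d + t *\<^sub>R z)) has_real_derivative (d \<bullet> z) / norm d) (at 0)"
proof -
  have "((\<lambda>t. d + t *\<^sub>R z) has_derivative (\<lambda>h. h *\<^sub>R z)) (at 0)"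
    by (auto intro!: derivative_eq_intros)
  moreover have "(norm has_derivative (\<lambda>h. h \<bullet> sgn d)) (at (d + 0 *\<^sub>R z))"
    using has_derivative_norm[OF assms] by simp
  ultimately have "((\<lambda>t. norm (d + t *\<^sub>R z)) has_derivative (\<lambda>h. (h *\<^sub>R z) \<bullet> sgn d)) (at 0)"
    using has_derivative_compose by blast
  moreover have "(\<lambda>h. (h *\<^sub>R z) \<bullet> sgn d) = (*) ((d \<bullet> z) / norm d)"
    by (auto simp: sgn_div_norm inner_commute field_simps)
  ultimately show ?thesis
    by (simp add: has_field_derivative_def)
qed

lemma edge_flex_norm_iff:
  assumes "p $ v \<noteq> p $ w"
  shows "edge_flex norm p z {v, w} \<longleftrightarrow> (p $ v - p $ w) \<bullet> (z $ v - z $ w) = 0"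
  using edge_flex_iff_derivative[OF _ has_real_derivative_norm_line, of p v w z] assms by simp

text \<open>
  The strict inequality persists for small \<open>t\<close>, so near \<open>t = 0\<close> the cylindrical length of the edge is
  the Euclidean length of its horizontal projection.
\<close>

lemma edge_flex_cyl_norm_fst_iff:
  assumes "\<bar>snd (p $ v - p $ w)\<bar> < norm (fst (p $ v - p $ w))"
  shows "edge_flex cyl_norm p z {v, w} \<longleftrightarrow>
    fst (p $ v - p $ w) \<bullet> fst (z $ v - z $ w) = 0"
proof -
  define d y where "d = p $ v - p $ w" and "y = z $ v - z $ w"
  have d: "fst d \<noteq> 0" using assms by (auto simp: d_def)
  have "isCont (\<lambda>t. norm (fst d + t *\<^sub>R fst y) - \<bar>snd d + t *\<^sub>R snd y\<bar>) 0"
    by (intro continuous_intros)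
  then have "\<forall>\<^sub>F t in at 0. 0 < norm (fst d + t *\<^sub>R fst y) - \<bar>snd d + t *\<^sub>R snd y\<bar>"
    using assms unfolding isCont_def d_def[symmetric]
    by (intro order_tendstoD(1)) auto
  then have "\<forall>\<^sub>F t in nhds 0. cyl_norm (d + t *\<^sub>R y) = norm (fst d + t *\<^sub>R fst y)"
    unfolding eventually_at_filter
    by eventually_elim (use assms in \<open>auto simp: cyl_norm_def d_def\<close>)
  then have "((\<lambda>t. cyl_norm (d + t *\<^sub>R y)) has_real_derivative (fst d \<bullet> fst y) / norm (fst d)) (at 0) \<longleftrightarrow>
      ((\<lambda>t. norm (fst d + t *\<^sub>R fst y)) has_real_derivative (fst d \<bullet> fst y) / norm (fst d)) (at 0)"
    by (intro DERIV_cong_ev refl)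
  then have "edge_flex cyl_norm p z {v, w} \<longleftrightarrow> (fst d \<bullet> fst y) / norm (fst d) = 0"
    using has_real_derivative_norm_line[OF d]
    unfolding d_def y_def by (intro edge_flex_iff_derivative cyl_norm_minus) blast
  then show ?thesis
    using d unfolding d_def y_def by simp
qed

lemma edge_flex_cyl_norm_snd_iff:
  assumes "norm (fst (p $ v - p $ w)) < \<bar>snd (p $ v - p $ w)\<bar>"
  shows "edge_flex cyl_norm p z {v, w} \<longleftrightarrow>
    snd (p $ v - p $ w) \<bullet> snd (z $ v - z $ w) = 0"
proof -
  define d y where "d = p $ v - p $ w" and "y = z $ v - z $ w"
  have d: "snd d \<noteq> 0" using assms by (auto simp: d_def)
  have "isCont (\<lambda>t. \<bar>snd d + t *\<^sub>R snd y\<bar> - norm (fst d + t *\<^sub>R fst y)) 0"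
    by (intro continuous_intros)
  then have "\<forall>\<^sub>F t in at 0. 0 < \<bar>snd d + t *\<^sub>R snd y\<bar> - norm (fst d + t *\<^sub>R fst y)"
    using assms unfolding isCont_def d_def[symmetric]
    by (intro order_tendstoD(1)) auto
  then have "\<forall>\<^sub>F t in nhds 0. cyl_norm (d + t *\<^sub>R y) = norm (snd d + t *\<^sub>R snd y)"
    unfolding eventually_at_filter
    by eventually_elim (use assms in \<open>auto simp: cyl_norm_def d_def\<close>)
  then have "((\<lambda>t. cyl_norm (d + t *\<^sub>R y)) has_real_derivative (snd d \<bullet> snd y) / norm (snd d)) (at 0) \<longleftrightarrow>
      ((\<lambda>t. norm (snd d + t *\<^sub>R snd y)) has_real_derivative (snd d \<bullet> snd y) / norm (snd d)) (at 0)"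
    by (intro DERIV_cong_ev refl)
  then have "edge_flex cyl_norm p z {v, w} \<longleftrightarrow> (snd d \<bullet> snd y) / norm (snd d) = 0"
    using has_real_derivative_norm_line[OF d]
    unfolding d_def y_def by (intro edge_flex_iff_derivative cyl_norm_minus) blast
  then show ?thesis
    using d unfolding d_def y_def by simp
qed

lemma infinitesimal_flex_norm_iff:
  fixes p :: "'a::euclidean_space ^ 'v::finite"
  assumes "bar_joint_framework E p"
  shows "infinitesimal_flex norm E p z \<longleftrightarrow>
    (\<forall>v w. {v, w} \<in> E \<longrightarrow> (p $ v - p $ w) \<bullet> (z $ v - z $ w) = 0)"
proof -
  have *: "\<And>e. e \<in> E \<Longrightarrow> \<exists>v w. e = {v, w}"
    using assms unfolding bar_joint_framework_def by (meson simple_graph_edgeE)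
  have "edge_flex norm p z {v, w} \<longleftrightarrow> (p $ v - p $ w) \<bullet> (z $ v - z $ w) = 0"
    if "{v, w} \<in> E" for v w
    using assms that by (intro edge_flex_norm_iff) (auto simp: bar_joint_framework_def)
  with * show ?thesis
    unfolding infinitesimal_flex_iff_edge_flex by blast
qed

lemma infinitesimal_flex_cyl_norm_iff:
  assumes wp: "well_positioned cyl_norm E p"
  shows "infinitesimal_flex cyl_norm E p z \<longleftrightarrow>
    infinitesimal_flex norm (monochrome_edges fst E p) (projected_placement fst p)
      (projected_placement fst z) \<and>
    infinitesimal_flex norm (monochrome_edges snd E p) (projected_placement snd p)
      (projected_placement snd z)"
proof -
  let ?E1 = "monochrome_edges fst E p" and ?E2 = "monochrome_edges snd E p"
  have sg: "simple_graph UNIV E"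
    using wp by (simp add: well_positioned_def bar_joint_framework_def)
  have edge: "\<And>e. e \<in> E \<Longrightarrow> \<exists>v w. e = {v, w}"
    using sg by (meson simple_graph_edgeE)
  have 1: "edge_flex cyl_norm p z e \<longleftrightarrow>
      edge_flex norm (projected_placement fst p) (projected_placement fst z) e"
    if "e \<in> ?E1" for e
  proof -
    have "e \<in> E" using that monochrome_edges_partition(1)[OF wp] by blast
    then obtain v w where "e = {v, w}" using edge by blast
    with that have "\<bar>snd (p $ v - p $ w)\<bar> < norm (fst (p $ v - p $ w))"
      using monochrome_edges_fst_iff[OF wp] by blast
    moreover from this have "projected_placement fst p $ v \<noteq> projected_placement fst p $ w"
      by (auto simp: projected_placement_def)
    ultimately show ?thesis
      unfolding \<open>e = {v, w}\<close>
      by (simp add: edge_flex_cyl_norm_fst_iff edge_flex_norm_iff)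
         (simp add: projected_placement_def)
  qed
  have 2: "edge_flex cyl_norm p z e \<longleftrightarrow>
      edge_flex norm (projected_placement snd p) (projected_placement snd z) e"
    if "e \<in> ?E2" for e
  proof -
    have "e \<in> E" using that monochrome_edges_partition(1)[OF wp] by blast
    then obtain v w where "e = {v, w}" using edge by blast
    with that have "norm (fst (p $ v - p $ w)) < \<bar>snd (p $ v - p $ w)\<bar>"
      using monochrome_edges_snd_iff[OF wp] by blast
    moreover from this have "projected_placement snd p $ v \<noteq> projected_placement snd p $ w"
      by (auto simp: projected_placement_def)
    ultimately show ?thesis
      unfolding \<open>e = {v, w}\<close>
      by (simp add: edge_flex_cyl_norm_snd_iff edge_flex_norm_iff)
         (simp add: projected_placement_def)
  qed
  have "infinitesimal_flex cyl_norm E p z \<longleftrightarrow> (\<forall>e\<in>?E1 \<union> ?E2. edge_flex cyl_norm p z e)"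
    unfolding infinitesimal_flex_iff_edge_flex monochrome_edges_partition(1)[OF wp] ..
  then show ?thesis
    unfolding infinitesimal_flex_iff_edge_flex using 1 2 by blast
qed


section \<open>Infinitesimal rigid motions\<close>

text \<open>
  Besides describing infinitesimal rotations, this map yields the two-dimensional cross product
  \<open>rot90 x \<bullet> y\<close>, which detects whether \<open>x\<close> and \<open>y\<close> are parallel.
\<close>

definition rot90 :: "real ^ 2 \<Rightarrow> real ^ 2" where
  "rot90 x = vector [- x $ 2, x $ 1]"

lemma rot90_nth [simp]: "rot90 x $ 1 = - x $ 2" "rot90 x $ 2 = x $ 1"
  by (simp_all add: rot90_def)

lemma inner_real2: "x \<bullet> y = x $ 1 * y $ 1 + x $ 2 * y $ 2" for x y :: "real ^ 2"
  by (simp add: inner_vec_def sum_2)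

lemma vec_eq_iff_2: "x = y \<longleftrightarrow> x $ 1 = y $ 1 \<and> x $ 2 = y $ 2" for x y :: "'a ^ 2"
  by (simp add: vec_eq_iff forall_2)

lemma linear_rot90: "linear rot90"
  by (rule linearI) (simp_all add: vec_eq_iff_2)

lemmas rot90_simps [simp] = linear_add[OF linear_rot90] linear_diff[OF linear_rot90]
  linear_scale[OF linear_rot90] linear_0[OF linear_rot90]

lemma rot90_inner_self [simp]: "rot90 x \<bullet> x = 0" "x \<bullet> rot90 x = 0"
  by (simp_all add: inner_real2)

lemma norm_rotation:
  "norm (cos t *\<^sub>R x + sin t *\<^sub>R rot90 x) = norm x"
proof -
  have "(cos t *\<^sub>R x + sin t *\<^sub>R rot90 x) \<bullet> (cos t *\<^sub>R x + sin t *\<^sub>R rot90 x) =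
      ((cos t)\<^sup>2 + (sin t)\<^sup>2) * (x \<bullet> x)"
    unfolding inner_real2 by (simp only: vector_add_component vector_scaleR_component rot90_nth real_scaleR_def) algebra
  then show ?thesis
    by (simp add: norm_eq_sqrt_inner)
qed

lemma orthogonal_derivative_of_constant_norm:
  fixes \<gamma> :: "real \<Rightarrow> 'a::euclidean_space"
  assumes \<gamma>: "(\<gamma> has_vector_derivative v) (at 0)"
    and const: "\<forall>\<^sub>F t in nhds 0. norm (\<gamma> t) = norm (\<gamma> 0)"
  shows "\<gamma> 0 \<bullet> v = 0"
proof -
  have "((\<lambda>t. \<gamma> t \<bullet> \<gamma> t) has_derivative (\<lambda>h. \<gamma> 0 \<bullet> (h *\<^sub>R v) + (h *\<^sub>R v) \<bullet> \<gamma> 0)) (at 0)"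
    using \<gamma> unfolding has_vector_derivative_def by (intro has_derivative_inner)
  moreover have "(\<lambda>h. \<gamma> 0 \<bullet> (h *\<^sub>R v) + (h *\<^sub>R v) \<bullet> \<gamma> 0) = (*) (2 * (\<gamma> 0 \<bullet> v))"
    by (auto simp: inner_commute)
  ultimately have 1: "((\<lambda>t. \<gamma> t \<bullet> \<gamma> t) has_real_derivative 2 * (\<gamma> 0 \<bullet> v)) (at 0)"
    by (simp add: has_field_derivative_def)
  have "\<forall>\<^sub>F t in nhds 0. \<gamma> t \<bullet> \<gamma> t = \<gamma> 0 \<bullet> \<gamma> 0"
    using const by eventually_elim (metis dot_square_norm)
  then have "((\<lambda>t. \<gamma> t \<bullet> \<gamma> t) has_real_derivative 0) (at 0) \<longleftrightarrow>
      ((\<lambda>t. \<gamma> 0 \<bullet> \<gamma> 0) has_real_derivative 0) (at 0)"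
    by (intro DERIV_cong_ev refl)
  then have "((\<lambda>t. \<gamma> t \<bullet> \<gamma> t) has_real_derivative 0) (at 0)"
    by simp
  with 1 show ?thesis
    using DERIV_unique by fastforce
qed

lemma eventually_nhds_0_unit_interval: "\<forall>\<^sub>F t in nhds (0::real). t \<in> {-1..1}"
  using eventually_nhds_in_open[of "{-1<..<1}" "0::real"]
  by (rule eventually_mono) auto

lemma rigid_motion_derivative:
  assumes "rigid_motion N \<alpha>"
  shows "((\<lambda>t. \<alpha> x t - \<alpha> y t) has_vector_derivative
     vector_derivative (\<alpha> x) (at 0) - vector_derivative (\<alpha> y) (at 0)) (at 0)"
  using assms unfolding rigid_motion_def
  by (intro has_vector_derivative_diff) (auto simp: vector_derivative_works[symmetric])

lemma infinitesimal_rigid_motions_norm_orthogonal: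
  assumes "\<eta> \<in> infinitesimal_rigid_motions norm"
  shows "(x - y) \<bullet> (\<eta> x - \<eta> y) = 0"
proof -
  obtain \<alpha> where \<alpha>: "rigid_motion norm \<alpha>" and \<eta>: "\<eta> = (\<lambda>x. vector_derivative (\<alpha> x) (at 0))"
    using assms by (auto simp: infinitesimal_rigid_motions_def)
  have 0: "\<alpha> x 0 - \<alpha> y 0 = x - y"
    using \<alpha> by (simp add: rigid_motion_def)
  have "\<forall>\<^sub>F t in nhds 0. norm (\<alpha> x t - \<alpha> y t) = norm (\<alpha> x 0 - \<alpha> y 0)"
    using eventually_nhds_0_unit_interval
    by eventually_elim (use \<alpha> 0 in \<open>auto simp: rigid_motion_def\<close>)
  from orthogonal_derivative_of_constant_norm[OF rigid_motion_derivative[OF \<alpha>] this]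
  show ?thesis
    unfolding 0 \<eta> .
qed

text \<open>
  Along a rigid motion, the difference of two points keeps its colour for small times, so its
  projection of that colour has constant length and hence a velocity orthogonal to it.
\<close>

lemma infinitesimal_rigid_motions_cyl_norm_orthogonal:
  assumes "\<eta> \<in> infinitesimal_rigid_motions cyl_norm"
  shows "\<bar>snd (x - y)\<bar> < norm (fst (x - y)) \<Longrightarrow> fst (x - y) \<bullet> fst (\<eta> x - \<eta> y) = 0"
    and "norm (fst (x - y)) < \<bar>snd (x - y)\<bar> \<Longrightarrow> snd (x - y) \<bullet> snd (\<eta> x - \<eta> y) = 0"
proof -
  obtain \<alpha> where \<alpha>: "rigid_motion cyl_norm \<alpha>"
    and \<eta>: "\<eta> = (\<lambda>x. vector_derivative (\<alpha> x) (at 0))"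
    using assms by (auto simp: infinitesimal_rigid_motions_def)
  define \<gamma> where "\<gamma> = (\<lambda>t. \<alpha> x t - \<alpha> y t)"
  have 0: "\<gamma> 0 = x - y"
    using \<alpha> unfolding rigid_motion_def \<gamma>_def by metis
  have d: "(\<gamma> has_vector_derivative \<eta> x - \<eta> y) (at 0)"
    unfolding \<gamma>_def \<eta> by (rule rigid_motion_derivative[OF \<alpha>])
  then have d1: "((\<lambda>t. fst (\<gamma> t)) has_vector_derivative fst (\<eta> x - \<eta> y)) (at 0)"
    and d2: "((\<lambda>t. snd (\<gamma> t)) has_vector_derivative snd (\<eta> x - \<eta> y)) (at 0)"
    by (rule bounded_linear.has_vector_derivative[OF bounded_linear_fst],
        rule bounded_linear.has_vector_derivative[OF bounded_linear_snd])
  have cont: "(\<gamma> \<longlongrightarrow> \<gamma> 0) (nhds 0)"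
    using has_vector_derivative_continuous[OF d]
    by (simp add: continuous_at tendsto_nhds_iff)
  have "cyl_norm (\<gamma> t) = cyl_norm (\<gamma> 0)" if "t \<in> {-1..1}" for t
    using \<alpha> that unfolding 0 unfolding rigid_motion_def \<gamma>_def by blast
  with eventually_nhds_0_unit_interval
  have const: "\<forall>\<^sub>F t in nhds 0. cyl_norm (\<gamma> t) = cyl_norm (\<gamma> 0)"
    by (rule eventually_mono)
  have lim: "((\<lambda>t. norm (fst (\<gamma> t)) - \<bar>snd (\<gamma> t)\<bar>) \<longlongrightarrow> norm (fst (\<gamma> 0)) - \<bar>snd (\<gamma> 0)\<bar>) (nhds 0)"
    by (intro tendsto_intros cont)
  show "fst (x - y) \<bullet> fst (\<eta> x - \<eta> y) = 0" if "\<bar>snd (x - y)\<bar> < norm (fst (x - y))"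
  proof -
    have "\<forall>\<^sub>F t in nhds 0. 0 < norm (fst (\<gamma> t)) - \<bar>snd (\<gamma> t)\<bar>"
      using that by (intro order_tendstoD(1)[OF lim]) (simp add: 0)
    with const have "\<forall>\<^sub>F t in nhds 0. norm (fst (\<gamma> t)) = norm (fst (\<gamma> 0))"
      by eventually_elim (use that in \<open>auto simp: cyl_norm_def 0\<close>)
    from orthogonal_derivative_of_constant_norm[OF d1 this] show ?thesis
      by (simp add: 0)
  qed
  show "snd (x - y) \<bullet> snd (\<eta> x - \<eta> y) = 0" if "norm (fst (x - y)) < \<bar>snd (x - y)\<bar>"
  proof -
    have "\<forall>\<^sub>F t in nhds 0. norm (fst (\<gamma> t)) - \<bar>snd (\<gamma> t)\<bar> < 0"
      using that by (intro order_tendstoD(2)[OF lim]) (simp add: 0)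
    with const have "\<forall>\<^sub>F t in nhds 0. norm (snd (\<gamma> t)) = norm (snd (\<gamma> 0))"
      by eventually_elim (use that in \<open>auto simp: cyl_norm_def 0\<close>)
    from orthogonal_derivative_of_constant_norm[OF d2 this] show ?thesis
      by (simp add: 0)
  qed
qed

text \<open>
  Subtracting the value at the origin leaves a map \<open>g\<close> with \<open>x \<bullet> g y = - (y \<bullet> g x)\<close>. Its components
  are inner products with the basis vectors, so skewness expresses \<open>g x\<close> through the values of \<open>g\<close> at
  the basis vectors; in particular \<open>g\<close> is linear and skew-symmetric.
\<close>

lemma plane_velocity_field:
  fixes \<eta> :: "real ^ 2 \<Rightarrow> real ^ 2"
  assumes orth: "\<And>x y. (x - y) \<bullet> (\<eta> x - \<eta> y) = 0"
  obtains s c where "\<And>x. \<eta> x = s *\<^sub>R rot90 x + c"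
proof
  define g where "g x = \<eta> x - \<eta> 0" for x
  have self: "x \<bullet> g x = 0" for x
    using orth[of x 0] by (simp add: g_def)
  have skew: "x \<bullet> g y = - (y \<bullet> g x)" for x y
    using orth[of x y] self[of x] self[of y]
    by (simp add: g_def inner_diff_left inner_diff_right)
  define s where "s = g (axis 1 1) $ 2"
  have 1: "g (axis 1 1) $ 1 = 0" "g (axis 2 1) $ 2 = 0" "g (axis 2 1) $ 1 = - s"
    using self[of "axis 1 1"] self[of "axis 2 1"] skew[of "axis 1 1" "axis 2 1"]
    by (simp_all add: inner_axis' s_def)
  have "g x $ 1 = - s * x $ 2" "g x $ 2 = s * x $ 1" for x
    using skew[of "axis 1 1" x] skew[of "axis 2 1" x] 1
    by (simp_all add: inner_axis') (simp_all add: inner_real2 s_def)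
  then have "g x = s *\<^sub>R rot90 x" for x
    by (simp add: vec_eq_iff_2)
  then show "\<eta> x = s *\<^sub>R rot90 x + \<eta> 0" for x
    unfolding g_def by (metis diff_add_cancel)
qed

text \<open>
  Every field \<open>s *\<^sub>R rot90 x + c\<close> arises from a rigid motion: rotate with angular velocity \<open>s\<close> and
  translate with velocity \<open>c\<close>.
\<close>

lemma screw_motion_derivative:
  "((\<lambda>t. cos (s * t) *\<^sub>R x + sin (s * t) *\<^sub>R rot90 x + t *\<^sub>R c) has_vector_derivative
     s *\<^sub>R rot90 x + c) (at 0)"
proof -
  have "((\<lambda>t. cos (s * t)) has_real_derivative 0) (at 0)"
    "((\<lambda>t. sin (s * t)) has_real_derivative s) (at 0)"
    "((\<lambda>t::real. t) has_real_derivative 1) (at 0)"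
    by (auto intro!: derivative_eq_intros)
  from this[THEN has_vector_derivative_scaleR, OF has_vector_derivative_const]
  have "((\<lambda>t. cos (s * t) *\<^sub>R x) has_vector_derivative 0) (at 0)"
    "((\<lambda>t. sin (s * t) *\<^sub>R rot90 x) has_vector_derivative s *\<^sub>R rot90 x) (at 0)"
    "((\<lambda>t. t *\<^sub>R c) has_vector_derivative c) (at 0)"
    by simp_all
  from has_vector_derivative_add[OF has_vector_derivative_add[OF this(1,2)] this(3)]
  show ?thesis by simp
qed

lemma norm_rotation_diff:
  "norm ((cos t *\<^sub>R x + sin t *\<^sub>R rot90 x) - (cos t *\<^sub>R y + sin t *\<^sub>R rot90 y)) = norm (x - y)"
  using norm_rotation[of t "x - y"] by (simp add: algebra_simps)

lemma infinitesimal_rigid_motionsI: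
  assumes "\<And>x. \<alpha> x 0 = x" "\<And>x t. t \<in> {-1..1} \<Longrightarrow> isCont (\<alpha> x) t"
    and "\<And>x. (\<alpha> x has_vector_derivative \<eta> x) (at 0)"
    and "\<And>x y t. N (\<alpha> x t - \<alpha> y t) = N (x - y)"
  shows "\<eta> \<in> infinitesimal_rigid_motions N"
proof -
  have "rigid_motion N \<alpha>"
    using assms differentiableI_vector[OF assms(3)] unfolding rigid_motion_def
    by (auto intro!: continuous_at_imp_continuous_on)
  moreover have "\<eta> = (\<lambda>x. vector_derivative (\<alpha> x) (at 0))"
    by (simp add: vector_derivative_at[OF assms(3)])
  ultimately show ?thesis
    by (auto simp: infinitesimal_rigid_motions_def)
qed

lemma infinitesimal_rigid_motions_plane:
  "infinitesimal_rigid_motions (norm :: real ^ 2 \<Rightarrow> real) =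
     {\<lambda>x. s *\<^sub>R rot90 x + c | s c. True}"
proof (intro equalityI subsetI)
  fix \<eta> assume "\<eta> \<in> infinitesimal_rigid_motions (norm :: real ^ 2 \<Rightarrow> real)"
  then obtain s c where "\<And>x. \<eta> x = s *\<^sub>R rot90 x + c"
    using plane_velocity_field infinitesimal_rigid_motions_norm_orthogonal by metis
  then have "\<eta> = (\<lambda>x. s *\<^sub>R rot90 x + c)" by auto
  then show "\<eta> \<in> {\<lambda>x. s *\<^sub>R rot90 x + c | s c. True}"
    by blast
next
  fix \<eta> assume "\<eta> \<in> {\<lambda>x. s *\<^sub>R rot90 x + c | s c. True}"
  then obtain s c where \<eta>: "\<eta> = (\<lambda>x. s *\<^sub>R rot90 x + c)" by auto
  show "\<eta> \<in> infinitesimal_rigid_motions norm"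
    unfolding \<eta>
    by (rule infinitesimal_rigid_motionsI
        [where \<alpha> = "\<lambda>x t. cos (s * t) *\<^sub>R x + sin (s * t) *\<^sub>R rot90 x + t *\<^sub>R c"])
      (auto intro!: screw_motion_derivative continuous_intros simp: norm_rotation_diff)
qed

lemma infinitesimal_rigid_motions_line:
  "infinitesimal_rigid_motions (norm :: real \<Rightarrow> real) = {\<lambda>x. c | c. True}"
proof (intro equalityI subsetI)
  fix \<eta> assume \<eta>: "\<eta> \<in> infinitesimal_rigid_motions (norm :: real \<Rightarrow> real)"
  have "(x - 0) * (\<eta> x - \<eta> 0) = 0" for x
    using infinitesimal_rigid_motions_norm_orthogonal[OF \<eta>, of x 0] unfolding inner_real_def .
  then have "\<eta> x = \<eta> 0" for x
    by (metis mult_eq_0_iff right_minus_eq)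
  then have "\<eta> = (\<lambda>x. \<eta> 0)" by (rule ext)
  then show "\<eta> \<in> {\<lambda>x. c | c. True}"
    by blast
next
  fix \<eta> :: "real \<Rightarrow> real" assume "\<eta> \<in> {\<lambda>x. c | c. True}"
  then obtain c where \<eta>: "\<eta> = (\<lambda>x. c)" by auto
  show "\<eta> \<in> infinitesimal_rigid_motions norm"
    unfolding \<eta>
    by (rule infinitesimal_rigid_motionsI[where \<alpha> = "\<lambda>x t. x + t * c"])
      (auto intro!: derivative_eq_intros continuous_intros simp: has_vector_derivative_def)
qed

text \<open>
  The orthogonality conditions hold only for pairs of points whose difference has the right colour.
  Each time, an auxiliary point far away in one direction supplies enough such pairs.
\<close>

lemma infinitesimal_rigid_motions_cyl_norm:
  "infinitesimal_rigid_motions cyl_norm =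
     {\<lambda>x. (\<eta>\<^sub>1 (fst x), \<eta>\<^sub>2 (snd x)) | \<eta>\<^sub>1 \<eta>\<^sub>2.
        \<eta>\<^sub>1 \<in> infinitesimal_rigid_motions norm \<and> \<eta>\<^sub>2 \<in> infinitesimal_rigid_motions norm}"
    (is "_ = ?R")
proof (intro equalityI subsetI)
  fix \<eta> assume \<eta>: "\<eta> \<in> infinitesimal_rigid_motions cyl_norm"
  note orth = infinitesimal_rigid_motions_cyl_norm_orthogonal[OF \<eta>]
  have snd_const: "snd (\<eta> x) = snd (\<eta> y)" for x y
  proof -
    \<comment> \<open>A point \<open>w\<close> so high above both \<open>x\<close> and \<open>y\<close> that \<open>x - w\<close> and \<open>y - w\<close> have colour 2.\<close>
    define h where "h = \<bar>snd x\<bar> + \<bar>snd y\<bar> + norm (fst x - fst y) + 1"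
    define w where "w = (fst x, h)"
    have "snd x < h" "norm (fst x - fst y) < \<bar>snd y - h\<bar>"
      using norm_ge_zero[of "fst x - fst y"] unfolding h_def by linarith+
    then have "norm (fst (x - w)) < \<bar>snd (x - w)\<bar>" "norm (fst (y - w)) < \<bar>snd (y - w)\<bar>"
      by (simp_all add: w_def norm_minus_commute)
    then have "snd (\<eta> x) = snd (\<eta> w)" "snd (\<eta> y) = snd (\<eta> w)"
      using orth(2)[of x w] orth(2)[of y w] by auto
    then show ?thesis by simp
  qed
  have fst_indep: "fst (\<eta> (a, s)) = fst (\<eta> (a, s'))" for a s s'
  proof -
    \<comment> \<open>At horizontal distance \<open>r\<close> from \<open>a\<close> and at height \<open>s\<close>, a point differs from both
      \<open>(a, s)\<close> and \<open>(a, s')\<close> by a vector of colour 1.\<close>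
    define r where "r = \<bar>s - s'\<bar> + 1"
    define \<delta> where "\<delta> = fst (\<eta> (a, s)) - fst (\<eta> (a, s'))"
    have "u \<bullet> \<delta> = 0" if "norm u = r" for u
    proof -
      have "u \<bullet> fst (\<eta> (a, s) - \<eta> (a - u, s)) = 0"
        using orth(1)[of "(a, s)" "(a - u, s)"] that by (simp add: r_def)
      moreover have "u \<bullet> fst (\<eta> (a, s') - \<eta> (a - u, s)) = 0"
        using orth(1)[of "(a, s')" "(a - u, s)"] that by (simp add: r_def)
      ultimately show ?thesis
        by (simp add: \<delta>_def inner_diff_right)
    qed
    from this[of "axis 1 r"] this[of "axis 2 r"] have "\<delta> = 0"
      by (auto simp: r_def inner_axis' inner_axis_axis vec_eq_iff_2 norm_eq_sqrt_inner)
    then show ?thesis by (simp add: \<delta>_def)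
  qed
  define \<eta>\<^sub>1 where "\<eta>\<^sub>1 a = fst (\<eta> (a, 0))" for a
  have "(x - y) \<bullet> (\<eta>\<^sub>1 x - \<eta>\<^sub>1 y) = 0" for x y
    using orth(1)[of "(x, 0)" "(y, 0)"] by (cases "x = y") (auto simp: \<eta>\<^sub>1_def)
  then obtain s c where "\<And>x. \<eta>\<^sub>1 x = s *\<^sub>R rot90 x + c"
    using plane_velocity_field by metis
  then have "\<eta>\<^sub>1 = (\<lambda>x. s *\<^sub>R rot90 x + c)" by auto
  then have "\<eta>\<^sub>1 \<in> infinitesimal_rigid_motions norm"
    unfolding infinitesimal_rigid_motions_plane by blast
  moreover have "(\<lambda>_. snd (\<eta> 0)) \<in> infinitesimal_rigid_motions (norm :: real \<Rightarrow> real)"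
    unfolding infinitesimal_rigid_motions_line by blast
  moreover have "\<eta> = (\<lambda>x. (\<eta>\<^sub>1 (fst x), snd (\<eta> 0)))"
  proof
    fix x show "\<eta> x = (\<eta>\<^sub>1 (fst x), snd (\<eta> 0))"
      using fst_indep[of "fst x" "snd x" 0] snd_const[of x 0]
      by (simp add: prod_eq_iff \<eta>\<^sub>1_def)
  qed
  ultimately show "\<eta> \<in> ?R"
    by (intro CollectI exI[of _ \<eta>\<^sub>1] exI[of _ "\<lambda>_. snd (\<eta> 0)"]) auto
next
  fix \<eta> assume "\<eta> \<in> ?R"
  then obtain s c k where \<eta>: "\<eta> = (\<lambda>x. (s *\<^sub>R rot90 (fst x) + c, k))"
    unfolding infinitesimal_rigid_motions_plane infinitesimal_rigid_motions_line by auto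
  show "\<eta> \<in> infinitesimal_rigid_motions cyl_norm"
    unfolding \<eta>
  proof (rule infinitesimal_rigid_motionsI
      [where \<alpha> = "\<lambda>x t. (cos (s * t) *\<^sub>R fst x + sin (s * t) *\<^sub>R rot90 (fst x) + t *\<^sub>R c, snd x + t * k)"])
    fix x :: "(real ^ 2) \<times> real"
    have "((\<lambda>t. snd x + t * k) has_vector_derivative k) (at 0)"
      by (auto intro!: derivative_eq_intros simp: has_vector_derivative_def)
    then show "((\<lambda>t. (cos (s * t) *\<^sub>R fst x + sin (s * t) *\<^sub>R rot90 (fst x) + t *\<^sub>R c, snd x + t * k))
        has_vector_derivative (s *\<^sub>R rot90 (fst x) + c, k)) (at 0)"
      by (intro has_vector_derivative_Pair screw_motion_derivative)
  next
    fix x y :: "(real ^ 2) \<times> real" and t :: real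
    show "cyl_norm ((cos (s * t) *\<^sub>R fst x + sin (s * t) *\<^sub>R rot90 (fst x) + t *\<^sub>R c, snd x + t * k) -
      (cos (s * t) *\<^sub>R fst y + sin (s * t) *\<^sub>R rot90 (fst y) + t *\<^sub>R c, snd y + t * k)) =
      cyl_norm (x - y)"
      by (simp add: cyl_norm_def norm_rotation_diff)
  qed (auto intro!: continuous_intros)
qed

section \<open>Rigidity splits along the two colours\<close>

lemma trivial_flex_cyl_norm_iff:
  "trivial_flex cyl_norm p z \<longleftrightarrow>
     trivial_flex norm (projected_placement fst p) (projected_placement fst z) \<and>
     trivial_flex norm (projected_placement snd p) (projected_placement snd z)"
proof
  assume "trivial_flex cyl_norm p z"
  then obtain \<eta>\<^sub>1 \<eta>\<^sub>2 where "\<eta>\<^sub>1 \<in> infinitesimal_rigid_motions norm" "\<eta>\<^sub>2 \<in> infinitesimal_rigid_motions norm"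
    and "z = (\<chi> v. (\<eta>\<^sub>1 (fst (p $ v)), \<eta>\<^sub>2 (snd (p $ v))))"
    unfolding trivial_flex_def infinitesimal_rigid_motions_cyl_norm by auto
  then show "trivial_flex norm (projected_placement fst p) (projected_placement fst z) \<and>
      trivial_flex norm (projected_placement snd p) (projected_placement snd z)"
    unfolding trivial_flex_def projected_placement_def by auto
next
  assume "trivial_flex norm (projected_placement fst p) (projected_placement fst z) \<and>
      trivial_flex norm (projected_placement snd p) (projected_placement snd z)"
  then obtain \<eta>\<^sub>1 \<eta>\<^sub>2 where "\<eta>\<^sub>1 \<in> infinitesimal_rigid_motions norm" "\<eta>\<^sub>2 \<in> infinitesimal_rigid_motions norm"
    and "projected_placement fst z = (\<chi> v. \<eta>\<^sub>1 (fst (p $ v)))"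
      "projected_placement snd z = (\<chi> v. \<eta>\<^sub>2 (snd (p $ v)))"
    unfolding trivial_flex_def projected_placement_def by auto
  moreover from this have "z = (\<chi> v. (\<eta>\<^sub>1 (fst (p $ v)), \<eta>\<^sub>2 (snd (p $ v))))"
    by (simp add: projected_placement_def vec_eq_iff prod_eq_iff)
  ultimately show "trivial_flex cyl_norm p z"
    unfolding trivial_flex_def infinitesimal_rigid_motions_cyl_norm by fastforce
qed

lemma infinitesimal_flex_zero: "infinitesimal_flex N E p 0"
  by (simp add: infinitesimal_flex_def)

theorem infinitesimally_rigid_cyl_norm_iff:
  assumes wp: "well_positioned cyl_norm E p"
  shows "infinitesimally_rigid cyl_norm E p \<longleftrightarrow>
    infinitesimally_rigid norm (monochrome_edges fst E p) (projected_placement fst p) \<and>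
    infinitesimally_rigid norm (monochrome_edges snd E p) (projected_placement snd p)"
    (is "_ \<longleftrightarrow> infinitesimally_rigid norm ?E1 ?p1 \<and> infinitesimally_rigid norm ?E2 ?p2")
proof
  assume rigid: "infinitesimally_rigid cyl_norm E p"
  have proj: "projected_placement fst (\<chi> v. (a $ v, b $ v)) = a"
    "projected_placement snd (\<chi> v. (a $ v, b $ v)) = b" for a :: "(real ^ 2) ^ 'a" and b
    by (simp_all add: projected_placement_def)
  have *: "trivial_flex norm ?p1 a \<and> trivial_flex norm ?p2 b"
    if "infinitesimal_flex norm ?E1 ?p1 a" "infinitesimal_flex norm ?E2 ?p2 b" for a b
  proof -
    have "infinitesimal_flex cyl_norm E p (\<chi> v. (a $ v, b $ v))"
      using that by (simp add: infinitesimal_flex_cyl_norm_iff[OF wp] proj)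
    with rigid have "trivial_flex cyl_norm p (\<chi> v. (a $ v, b $ v))"
      by (simp add: infinitesimally_rigid_def)
    then show ?thesis
      by (simp add: trivial_flex_cyl_norm_iff proj)
  qed
  show "infinitesimally_rigid norm ?E1 ?p1 \<and> infinitesimally_rigid norm ?E2 ?p2"
    using *[OF _ infinitesimal_flex_zero] *[OF infinitesimal_flex_zero]
    by (simp add: infinitesimally_rigid_def)
next
  assume "infinitesimally_rigid norm ?E1 ?p1 \<and> infinitesimally_rigid norm ?E2 ?p2"
  then show "infinitesimally_rigid cyl_norm E p"
    by (simp add: infinitesimally_rigid_def infinitesimal_flex_cyl_norm_iff[OF wp]
        trivial_flex_cyl_norm_iff)
qed

text \<open>
  Deleting an edge changes only the monochrome subgraph of its colour, while the other one stays
  rigid; so the edge is redundant in \<open>E\<close> exactly if it is redundant in its own colour.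
\<close>

theorem minimally_infinitesimally_rigid_cyl_norm_iff:
  assumes wp: "well_positioned cyl_norm E p"
  shows "minimally_infinitesimally_rigid cyl_norm E p \<longleftrightarrow>
    minimally_infinitesimally_rigid norm (monochrome_edges fst E p) (projected_placement fst p) \<and>
    minimally_infinitesimally_rigid norm (monochrome_edges snd E p) (projected_placement snd p)"
    (is "_ \<longleftrightarrow> minimally_infinitesimally_rigid norm ?E1 ?p1 \<and>
      minimally_infinitesimally_rigid norm ?E2 ?p2")
proof -
  note part = monochrome_edges_partition[OF wp]
  have del: "infinitesimally_rigid cyl_norm (E - {e}) p \<longleftrightarrow>
      infinitesimally_rigid norm (?E1 - {e}) ?p1 \<and> infinitesimally_rigid norm (?E2 - {e}) ?p2" for e
    using infinitesimally_rigid_cyl_norm_iff[OF well_positioned_subset[OF wp, of "E - {e}"]]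
    by (simp add: monochrome_edges_diff)
  have 1: "?E2 - {e} = ?E2" if "e \<in> ?E1" for e using that part by blast
  have 2: "?E1 - {e} = ?E1" if "e \<in> ?E2" for e using that part by blast
  have "(\<forall>e\<in>E. \<not> infinitesimally_rigid cyl_norm (E - {e}) p) \<longleftrightarrow>
    (\<forall>e\<in>?E1. \<not> (infinitesimally_rigid norm (?E1 - {e}) ?p1 \<and> infinitesimally_rigid norm ?E2 ?p2)) \<and>
    (\<forall>e\<in>?E2. \<not> (infinitesimally_rigid norm ?E1 ?p1 \<and> infinitesimally_rigid norm (?E2 - {e}) ?p2))"
  proof -
    have "(\<forall>e\<in>E. \<not> infinitesimally_rigid cyl_norm (E - {e}) p) \<longleftrightarrow>
      (\<forall>e\<in>?E1. \<not> infinitesimally_rigid cyl_norm (E - {e}) p) \<and>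
      (\<forall>e\<in>?E2. \<not> infinitesimally_rigid cyl_norm (E - {e}) p)"
      using part(1) by blast
    then show ?thesis
      unfolding del by (simp add: 1 2 cong: ball_cong)
  qed
  then show ?thesis
    unfolding minimally_infinitesimally_rigid_def infinitesimally_rigid_cyl_norm_iff[OF wp] by blast
qed


section \<open>Rigidity on the line and trees\<close>

lemma trivial_flex_line_iff: "trivial_flex norm p z \<longleftrightarrow> (\<forall>v w. z $ v = z $ w)"
  for p :: "real ^ 'v::finite"
proof
  assume "\<forall>v w. z $ v = z $ w"
  then have "z = (\<chi> v. z $ (SOME v. True))"
    by (simp add: vec_eq_iff)
  then show "trivial_flex norm p z"
    unfolding trivial_flex_def infinitesimal_rigid_motions_line by auto
qed (auto simp: trivial_flex_def infinitesimal_rigid_motions_line)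

lemma infinitesimal_flex_line_iff:
  fixes p :: "real ^ 'v::finite"
  assumes "bar_joint_framework E p"
  shows "infinitesimal_flex norm E p z \<longleftrightarrow> (\<forall>v w. {v, w} \<in> E \<longrightarrow> z $ v = z $ w)"
  using assms unfolding infinitesimal_flex_norm_iff[OF assms]
  by (fastforce simp: bar_joint_framework_def)

text \<open>
  The indicator function of the vertices reachable from \<open>u\<close> is a flex, and it is constant only if
  every vertex is reachable.
\<close>

lemma infinitesimally_rigid_line_iff_connected:
  fixes p :: "real ^ 'v::finite"
  assumes fw: "bar_joint_framework E p"
  shows "infinitesimally_rigid norm E p \<longleftrightarrow> connected_graph UNIV E"
proof
  assume rigid: "infinitesimally_rigid norm E p"
  show "connected_graph UNIV E"
    unfolding connected_graph_def
  proof (intro conjI ballI)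
    fix u v :: 'v
    let ?R = "{(a, b). {a, b} \<in> E}"
    define z :: "real ^ 'v" where "z = (\<chi> x. if (u, x) \<in> ?R\<^sup>* then 1 else 0)"
    have "(u, a) \<in> ?R\<^sup>* \<longleftrightarrow> (u, b) \<in> ?R\<^sup>*" if "{a, b} \<in> E" for a b
    proof -
      have "(a, b) \<in> ?R" "(b, a) \<in> ?R"
        using that by (simp_all add: insert_commute)
      then show ?thesis
        by (meson rtrancl.rtrancl_into_rtrancl)
    qed
    then have "infinitesimal_flex norm E p z"
      by (simp add: infinitesimal_flex_line_iff[OF fw] z_def)
    with rigid have "z $ v = z $ u"
      unfolding infinitesimally_rigid_def trivial_flex_line_iff by blast
    then show "(u, v) \<in> ?R\<^sup>*"
      by (simp add: z_def split: if_splits)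
  qed simp
next
  assume conn: "connected_graph UNIV E"
  show "infinitesimally_rigid norm E p"
    unfolding infinitesimally_rigid_def trivial_flex_line_iff infinitesimal_flex_line_iff[OF fw]
  proof (intro allI impI)
    fix z :: "real ^ 'v" and v w
    assume z: "\<forall>v w. {v, w} \<in> E \<longrightarrow> z $ v = z $ w"
    have "(v, w) \<in> {(a, b). {a, b} \<in> E}\<^sup>*"
      using conn by (simp add: connected_graph_def)
    then show "z $ v = z $ w"
      by induction (use z in auto)
  qed
qed

text \<open>
  Prepending a vertex that already occurs on a path creates a loop; cutting the loop off keeps the
  vertices distinct.
\<close>

lemma rtrancl_distinct_path:
  assumes "(u, w) \<in> R\<^sup>*"
  obtains xs where "xs \<noteq> []" "hd xs = u" "last xs = w" "distinct xs"
    "successively (\<lambda>a b. (a, b) \<in> R) xs"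
proof -
  have "\<exists>xs. xs \<noteq> [] \<and> hd xs = u \<and> last xs = w \<and> distinct xs \<and>
      successively (\<lambda>a b. (a, b) \<in> R) xs"
    using assms
  proof (induction rule: converse_rtrancl_induct)
    case base
    show ?case by (rule exI[of _ "[w]"]) simp
  next
    case (step u y)
    then obtain xs where xs: "xs \<noteq> []" "hd xs = y" "last xs = w" "distinct xs"
      "successively (\<lambda>a b. (a, b) \<in> R) xs" by blast
    show ?case
    proof (cases "u \<in> set xs")
      case True
      then obtain as bs where split: "xs = as @ u # bs"
        by (meson split_list)
      with xs show ?thesis
        by (intro exI[of _ "u # bs"]) (auto simp: successively_append_iff)
    next
      case False
      with xs step show ?thesis
        by (intro exI[of _ "u # xs"]) (cases xs; auto)
    qed
  qed
  then show thesis using that by blast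
qed

text \<open>
  The closing edge of a cycle can be replaced by the walk along the remaining edges of the cycle.
\<close>

lemma connected_graph_delete_cycle_edge:
  assumes conn: "connected_graph V E" and c: "is_cycle E c"
  obtains e where "e \<in> E" "connected_graph V (E - {e})"
proof -
  define n where "n = length c"
  have n: "n \<ge> 3" and dist: "distinct c"
    and edge: "\<And>i. i < n \<Longrightarrow> {c ! i, c ! (Suc i mod n)} \<in> E"
    using c by (auto simp: is_cycle_def n_def)
  define e where "e = {c ! (n - 1), c ! 0}"
  let ?R = "{(a, b). {a, b} \<in> E - {e}}"
  have "e \<in> E"
    using edge[of "n - 1"] n by (simp add: e_def)
  have path: "(c ! 0, c ! i) \<in> ?R\<^sup>*" if "i < n" for i
    using that
  proof (induction i)
    case (Suc i)
    have "c ! i = c ! j \<longleftrightarrow> i = j" "c ! Suc i = c ! j \<longleftrightarrow> Suc i = j" if "j < n" for j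
      using nth_eq_iff_index_eq[OF dist, of i j] nth_eq_iff_index_eq[OF dist, of "Suc i" j]
        Suc.prems that unfolding n_def by linarith+
    then have "c ! i = c ! 0 \<longleftrightarrow> i = 0" "c ! Suc i \<noteq> c ! 0" "c ! i \<noteq> c ! (n - 1)"
        "c ! Suc i = c ! (n - 1) \<longleftrightarrow> Suc i = n - 1"
      using Suc.prems n by auto
    then have "{c ! i, c ! Suc i} \<noteq> e"
      using n unfolding e_def doubleton_eq_iff by linarith
    moreover have "{c ! i, c ! Suc i} \<in> E"
      using edge[of i] Suc.prems by simp
    ultimately show ?case
      using Suc by (auto intro: rtrancl_into_rtrancl)
  qed simp
  have sym: "sym (?R\<^sup>*)"
    by (intro sym_rtrancl symI) (auto simp: insert_commute)
  have ends: "(c ! 0, c ! (n - 1)) \<in> ?R\<^sup>*" "(c ! (n - 1), c ! 0) \<in> ?R\<^sup>*"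
    using path[of "n - 1"] n symD[OF sym] by auto
  have "(a, b) \<in> ?R\<^sup>*" if "{a, b} \<in> E" for a b
  proof (cases "{a, b} = e")
    case True
    then show ?thesis
      using ends unfolding e_def doubleton_eq_iff by blast
  next
    case False
    with that show ?thesis by blast
  qed
  then have "{(a, b). {a, b} \<in> E}\<^sup>* \<subseteq> ?R\<^sup>*"
    by (intro rtrancl_subset_rtrancl) auto
  with conn have "connected_graph V (E - {e})"
    unfolding connected_graph_def by blast
  with \<open>e \<in> E\<close> that show thesis by blast
qed

text \<open>
  If deleting \<open>e\<close> keeps the graph connected, a simple path between the ends of \<open>e\<close> avoids \<open>e\<close> and is
  closed to a cycle by \<open>e\<close>. It has at least three vertices, because the only path with two vertices
  would use \<open>e\<close> itself.
\<close>

lemma cycle_through_non_bridge: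
  assumes sg: "simple_graph V E" and e: "e \<in> E" and conn: "connected_graph V (E - {e})"
  shows "\<exists>c. is_cycle E c"
proof -
  from sg e obtain u w where uw: "e = {u, w}" "u \<noteq> w"
    by (rule simple_graph_edgeE)
  have "u \<in> V" "w \<in> V"
    using sg e uw by (auto simp: simple_graph_def)
  with conn have "(u, w) \<in> {(a, b). {a, b} \<in> E - {e}}\<^sup>*"
    by (simp add: connected_graph_def)
  then obtain xs where xs: "xs \<noteq> []" "hd xs = u" "last xs = w" "distinct xs"
    "successively (\<lambda>a b. (a, b) \<in> {(a, b). {a, b} \<in> E - {e}}) xs"
    by (rule rtrancl_distinct_path)
  have step: "{xs ! i, xs ! Suc i} \<in> E - {e}" if "Suc i < length xs" for i
    using xs(5) that by (simp add: successively_conv_nth)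
  have ends: "xs ! 0 = u" "xs ! (length xs - 1) = w"
    using xs by (simp_all add: hd_conv_nth last_conv_nth)
  have "length xs \<noteq> 0" "length xs \<noteq> 1" "length xs \<noteq> 2"
    using xs(1) ends uw step[of 0] by auto
  then have len: "length xs \<ge> 3" by linarith
  have "{xs ! i, xs ! (Suc i mod length xs)} \<in> E" if "i < length xs" for i
  proof (cases "Suc i < length xs")
    case True
    then show ?thesis using step by simp
  next
    case False
    with that have i: "Suc i = length xs" by simp
    then have "xs ! i = w" using ends(2) by (metis diff_Suc_1)
    with i ends(1) e uw show ?thesis by (simp add: insert_commute)
  qed
  with len xs(4) have "is_cycle E xs"
    by (simp add: is_cycle_def)
  then show ?thesis ..
qed

lemma tree_graph_iff_minimally_connected:
  assumes sg: "simple_graph V E"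
  shows "tree_graph V E \<longleftrightarrow>
    connected_graph V E \<and> (\<forall>e\<in>E. \<not> connected_graph V (E - {e}))"
  unfolding tree_graph_def
  using sg connected_graph_delete_cycle_edge cycle_through_non_bridge by metis

theorem minimally_infinitesimally_rigid_line_iff_tree:
  fixes p :: "real ^ 'v::finite"
  assumes fw: "bar_joint_framework E p"
  shows "minimally_infinitesimally_rigid norm E p \<longleftrightarrow> tree_graph UNIV E"
proof -
  have "infinitesimally_rigid norm (E - {e}) p \<longleftrightarrow> connected_graph UNIV (E - {e})" for e
    by (intro infinitesimally_rigid_line_iff_connected bar_joint_framework_subset[OF fw]) auto
  moreover have "simple_graph UNIV E"
    using fw by (simp add: bar_joint_framework_def)
  ultimately show ?thesis
    by (simp add: minimally_infinitesimally_rigid_def tree_graph_iff_minimally_connected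
        infinitesimally_rigid_line_iff_connected[OF fw])
qed


section \<open>Rigidity matrices\<close>

text \<open>
  The row of the rigidity matrix that belongs to the edge \<open>e\<close>. For \<open>e = {v, w}\<close> the entry at \<open>v\<close> is
  \<open>x $ v - x $ w\<close>, written as \<open>2 x\<^sub>v - (x\<^sub>v + x\<^sub>w)\<close> in order to avoid choosing an orientation of \<open>e\<close>.
  The row is not divided by the edge length, so it is linear in \<open>x\<close>.
\<close>

definition rigidity_row :: "'a::euclidean_space ^ 'v \<Rightarrow> 'v::finite set \<Rightarrow> 'a ^ 'v" where
  "rigidity_row x e = (\<chi> u. if u \<in> e then 2 *\<^sub>R x $ u - (\<Sum>w\<in>e. x $ w) else 0)"

lemma rigidity_row_nth_edge:
  assumes "v \<noteq> w"
  shows "rigidity_row x {v, w} $ v = x $ v - x $ w" "rigidity_row x {v, w} $ w = x $ w - x $ v"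
  using assms by (simp_all add: rigidity_row_def scaleR_2)

lemma rigidity_row_nth_outside: "u \<notin> e \<Longrightarrow> rigidity_row x e $ u = 0"
  by (simp add: rigidity_row_def)

lemma rigidity_row_inner:
  assumes "v \<noteq> w"
  shows "rigidity_row x {v, w} \<bullet> z = (x $ v - x $ w) \<bullet> (z $ v - z $ w)"
proof -
  have "rigidity_row x {v, w} \<bullet> z = (\<Sum>u\<in>{v, w}. rigidity_row x {v, w} $ u \<bullet> z $ u)"
    unfolding inner_vec_def by (rule sum.mono_neutral_right) (auto simp: rigidity_row_nth_outside)
  also have "\<dots> = (x $ v - x $ w) \<bullet> (z $ v - z $ w)"
    using assms by (simp add: rigidity_row_nth_edge inner_diff_left inner_diff_right)
  finally show ?thesis .
qed

lemma rigidity_row_add: "rigidity_row (x + t *\<^sub>R y) e = rigidity_row x e + t *\<^sub>R rigidity_row y e"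
  by (simp add: rigidity_row_def vec_eq_iff sum.distrib scaleR_sum_right algebra_simps)

definition flex_space :: "'v::finite set set \<Rightarrow> 'a::euclidean_space ^ 'v \<Rightarrow> ('a ^ 'v) set" where
  "flex_space E p = {z. \<forall>e\<in>E. rigidity_row p e \<bullet> z = 0}"

lemma infinitesimal_flex_norm_iff_flex_space:
  assumes fw: "bar_joint_framework E p"
  shows "infinitesimal_flex norm E p z \<longleftrightarrow> z \<in> flex_space E p"
proof -
  have sg: "simple_graph UNIV E"
    using fw by (simp add: bar_joint_framework_def)
  have ne: "v \<noteq> w" if "{v, w} \<in> E" for v w
    using sg that by (auto simp: simple_graph_def)
  have "\<exists>v w. e = {v, w}" if "e \<in> E" for e
    using sg that by (meson simple_graph_edgeE)
  then show ?thesis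
    unfolding infinitesimal_flex_norm_iff[OF fw] flex_space_def mem_Collect_eq
    by (metis ne rigidity_row_inner)
qed

lemma subspace_flex_space: "subspace (flex_space E p)"
  by (auto simp: subspace_def flex_space_def inner_right_distrib)

lemma flex_space_eq_span:
  "flex_space E p = {z \<in> UNIV. \<forall>r\<in>span (rigidity_row p ` E). orthogonal r z}"
proof -
  have "r \<bullet> z = 0" if "z \<in> flex_space E p" "r \<in> span (rigidity_row p ` E)" for r z
  proof -
    have "orthogonal z r"
      using that(1) by (intro orthogonal_to_span[OF that(2)])
        (auto simp: flex_space_def orthogonal_def inner_commute[of z])
    then show ?thesis by (simp add: orthogonal_def inner_commute)
  qed
  moreover have "z \<in> flex_space E p" if "\<forall>r\<in>span (rigidity_row p ` E). orthogonal r z" for z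
    using that unfolding flex_space_def orthogonal_def by (blast intro: span_base)
  ultimately show ?thesis
    by (auto simp: orthogonal_def)
qed

lemma dim_flex_space:
  fixes p :: "'a::euclidean_space ^ 'v::finite"
  shows "dim (flex_space E p) + dim (rigidity_row p ` E) = CARD('v) * DIM('a)"
  using dim_subspace_orthogonal_to_vectors[of "span (rigidity_row p ` E)" UNIV]
  by (simp add: flex_space_eq_span)

text \<open>
  Rank-nullity: the map is injective on the orthogonal complement of its kernel and has the same range
  there.
\<close>

lemma dim_kernel_range:
  fixes f :: "'a::euclidean_space \<Rightarrow> 'b::euclidean_space"
  assumes "linear f"
  shows "dim {x. f x = 0} + dim (range f) = DIM('a)"
proof -
  let ?K = "{x. f x = 0}"
  define C where "C = {y \<in> UNIV. \<forall>x\<in>?K. orthogonal x y}"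
  have sub: "subspace ?K"
    using assms by (simp add: linear_subspace_kernel)
  have "subspace C"
    by (auto simp: C_def subspace_def orthogonal_def inner_right_distrib)
  have span: "span ?K = ?K" "span C = C"
    using sub \<open>subspace C\<close> by simp_all
  have "range f \<subseteq> f ` C"
  proof (rule image_subsetI)
    fix x :: 'a
    obtain y z where "y \<in> span ?K" "\<And>w. w \<in> span ?K \<Longrightarrow> orthogonal z w" "x = y + z"
      using orthogonal_subspace_decomp_exists[of ?K x] by blast
    then have "f x = f z" "z \<in> C"
      unfolding span using assms by (auto simp: linear_add C_def orthogonal_commute)
    then show "f x \<in> f ` C" by blast
  qed
  then have "range f = f ` C" by blast
  moreover have "inj_on f (span C)"
  proof (rule inj_onI)
    fix x y assume "x \<in> span C" "y \<in> span C" "f x = f y"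
    then have "x - y \<in> C" "x - y \<in> ?K"
      unfolding span using \<open>subspace C\<close> assms by (auto simp: subspace_diff linear_diff)
    then have "orthogonal (x - y) (x - y)"
      unfolding C_def by blast
    then show "x = y" by (simp add: orthogonal_self)
  qed
  ultimately have "dim (range f) = dim C"
    using dim_image_eq[OF assms] by metis
  then show ?thesis
    using dim_subspace_orthogonal_to_vectors[OF sub subspace_UNIV] by (simp add: C_def)
qed

lemma rigidity_map_has_derivative:
  assumes fw: "bar_joint_framework E x"
  shows "(rigidity_map norm E has_derivative
    (\<lambda>z. \<chi> e. if e \<in> E then rigidity_row x e \<bullet> z / edge_length norm x e else 0)) (at x)"
proof -
  have comp: "((\<lambda>y. rigidity_map norm E y $ e) has_derivative
     (\<lambda>z. if e \<in> E then rigidity_row x e \<bullet> z / edge_length norm x e else 0)) (at x)" for e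
  proof (cases "e \<in> E")
    case True
    from fw True obtain v w where e: "e = {v, w}" "v \<noteq> w"
      unfolding bar_joint_framework_def by (meson simple_graph_edgeE)
    with fw True have ne: "x $ v - x $ w \<noteq> 0"
      by (auto simp: bar_joint_framework_def)
    have "((\<lambda>y. y $ v - y $ w) has_derivative (\<lambda>z. z $ v - z $ w)) (at x)"
      by (intro has_derivative_diff bounded_linear_imp_has_derivative bounded_linear_vec_nth)
    from has_derivative_compose[OF this has_derivative_norm[OF ne]]
    have "((\<lambda>y. norm (y $ v - y $ w)) has_derivative (\<lambda>z. (z $ v - z $ w) \<bullet> sgn (x $ v - x $ w))) (at x)" .
    moreover have "(z $ v - z $ w) \<bullet> sgn (x $ v - x $ w) = rigidity_row x e \<bullet> z / edge_length norm x e" for z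
      unfolding e(1) rigidity_row_inner[OF e(2)] edge_length_insert[of norm, OF norm_minus_cancel]
      by (simp add: sgn_div_norm divide_inverse inner_commute[of "z $ v - z $ w"])
    ultimately show ?thesis
      using True by (simp add: rigidity_map_def e(1) edge_length_insert)
  next
    case False
    then show ?thesis by (simp add: rigidity_map_def)
  qed
  show ?thesis
    unfolding has_derivative_componentwise_within[of "rigidity_map norm E"]
    using comp by (auto simp: Basis_vec_def inner_axis)
qed

text \<open>
  Normalising the rows by the edge lengths does not change the kernel of the matrix. This kernel is the
  space of flexes, so rank-nullity reduces the rank of the differential to the row rank.
\<close>

lemma rigidity_rank_norm:
  assumes fw: "bar_joint_framework E x"
  shows "rigidity_rank norm E x = dim (rigidity_row x ` E)"
proof -
  let ?D = "\<lambda>z. \<chi> e. if e \<in> E then rigidity_row x e \<bullet> z / edge_length norm x e else 0"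
  note D = rigidity_map_has_derivative[OF fw]
  have "linear ?D"
    using D by (rule has_derivative_linear)
  have len: "edge_length norm x e \<noteq> 0" if e: "e \<in> E" for e
  proof -
    from fw e obtain v w where vw: "e = {v, w}"
      unfolding bar_joint_framework_def by (meson simple_graph_edgeE)
    with fw e show ?thesis
      by (auto simp: bar_joint_framework_def edge_length_insert)
  qed
  have "{z. ?D z = 0} = flex_space E x"
    using len by (auto simp: flex_space_def vec_eq_iff)
  then have "dim (flex_space E x) + dim (range ?D) = dim (flex_space E x) + dim (rigidity_row x ` E)"
    using dim_kernel_range[OF \<open>linear ?D\<close>] dim_flex_space[of E x] by simp
  moreover have "rigidity_rank norm E x = dim (range ?D)"
    unfolding rigidity_rank_def using frechet_derivative_at[OF D, symmetric] by simp
  ultimately show ?thesis by simp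
qed

section \<open>Stress-free placements\<close>

text \<open>
  Independence of the rows as an indexed family: two different edges with equal rows count as
  dependent.
\<close>

definition stress_free :: "'a::euclidean_space ^ 'v \<Rightarrow> 'v::finite set set \<Rightarrow> bool" where
  "stress_free x E \<longleftrightarrow>
     (\<forall>\<omega>. (\<Sum>e\<in>E. \<omega> e *\<^sub>R rigidity_row x e) = 0 \<longrightarrow> (\<forall>e\<in>E. \<omega> e = 0))"

lemma dim_rigidity_row_le: "dim (rigidity_row x ` E) \<le> card E"
  by (meson card_image_le dim_le_card' finite_class.finite_code finite_imageI le_trans)

lemma stress_freeD:
  "stress_free x E \<Longrightarrow> (\<Sum>e\<in>E. \<omega> e *\<^sub>R rigidity_row x e) = 0 \<Longrightarrow> e \<in> E \<Longrightarrow> \<omega> e = 0"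
  by (auto simp: stress_free_def)

text \<open>
  Two edges with the same row \<open>r\<close> would carry the stress with coefficients 1 and -1, so the rows are
  pairwise distinct and the dimension counts edges.
\<close>

lemma stress_free_imp_dim:
  assumes sf: "stress_free x E"
  shows "dim (rigidity_row x ` E) = card E"
proof -
  have inj: "inj_on (rigidity_row x) E"
  proof (rule inj_onI, rule ccontr)
    fix e f assume ef: "e \<in> E" "f \<in> E" "rigidity_row x e = rigidity_row x f" "e \<noteq> f"
    define \<omega> where "\<omega> g = (if g = e then 1 else if g = f then - 1 else 0 :: real)" for g
    have "(\<Sum>g\<in>E. \<omega> g *\<^sub>R rigidity_row x g) = (\<Sum>g\<in>{e, f}. \<omega> g *\<^sub>R rigidity_row x g)"
      using ef by (intro sum.mono_neutral_right) (auto simp: \<omega>_def)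
    also have "\<dots> = 0"
      by (subst sum.insert) (simp_all add: \<omega>_def ef(3) ef(4) ef(4)[symmetric])
    finally have "\<omega> e = 0"
      using sf ef(1) unfolding stress_free_def by blast
    then show False by (simp add: \<omega>_def)
  qed
  have "independent (rigidity_row x ` E)"
    unfolding independent_explicit
  proof (intro conjI allI impI)
    fix c assume "(\<Sum>v\<in>rigidity_row x ` E. c v *\<^sub>R v) = 0"
    then have "(\<Sum>e\<in>E. c (rigidity_row x e) *\<^sub>R rigidity_row x e) = 0"
      by (simp add: sum.reindex[OF inj])
    from stress_freeD[OF sf this] show "\<forall>v\<in>rigidity_row x ` E. c v = 0"
      by blast
  qed simp
  then show ?thesis
    by (simp add: dim_eq_card_independent card_image[OF inj])
qed

lemma stress_free_if_notin_span:
  assumes "\<And>e. e \<in> E \<Longrightarrow> rigidity_row x e \<notin> span (rigidity_row x ` (E - {e}))"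
  shows "stress_free x E"
  unfolding stress_free_def
proof (intro allI impI ballI, rule ccontr)
  fix \<omega> e assume sum: "(\<Sum>e\<in>E. \<omega> e *\<^sub>R rigidity_row x e) = 0" and e: "e \<in> E" "\<omega> e \<noteq> 0"
  have "\<omega> e *\<^sub>R rigidity_row x e = - (\<Sum>f\<in>E - {e}. \<omega> f *\<^sub>R rigidity_row x f)"
    using sum e(1) by (simp add: sum.remove[of E e] eq_neg_iff_add_eq_0)
  also have "\<dots> \<in> span (rigidity_row x ` (E - {e}))"
    by (intro span_neg span_sum span_scale span_base) auto
  finally have "(1 / \<omega> e) *\<^sub>R (\<omega> e *\<^sub>R rigidity_row x e) \<in> span (rigidity_row x ` (E - {e}))"
    by (rule span_scale)
  then show False
    using assms e by simp
qed

lemma stress_free_subset: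
  assumes sf: "stress_free x E" and "F \<subseteq> E"
  shows "stress_free x F"
  unfolding stress_free_def
proof (intro allI impI)
  fix \<omega> assume sum: "(\<Sum>e\<in>F. \<omega> e *\<^sub>R rigidity_row x e) = 0"
  define \<omega>' where "\<omega>' e = (if e \<in> F then \<omega> e else 0)" for e
  have "(\<Sum>e\<in>E. \<omega>' e *\<^sub>R rigidity_row x e) = (\<Sum>e\<in>F. \<omega> e *\<^sub>R rigidity_row x e)"
    using \<open>F \<subseteq> E\<close> by (intro sum.mono_neutral_cong_right) (auto simp: \<omega>'_def)
  with sum sf have "\<forall>e\<in>E. \<omega>' e = 0"
    unfolding stress_free_def by simp
  with \<open>F \<subseteq> E\<close> show "\<forall>e\<in>F. \<omega> e = 0"
    by (auto simp: \<omega>'_def split: if_splits)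
qed


section \<open>Counting degrees of freedom in the plane\<close>

text \<open>
  The velocity field of an infinitesimal rigid motion of the plane, cut off outside \<open>W\<close>. The
  parameters \<open>(s, c)\<close> form the three-dimensional space of angular and linear velocities, so dimensions
  of spaces of motions are dimensions of ranges of this linear map.
\<close>

definition motion_on :: "'v set \<Rightarrow> (real ^ 2) ^ 'v \<Rightarrow> real \<times> (real ^ 2) \<Rightarrow> (real ^ 2) ^ 'v::finite" where
  "motion_on W p = (\<lambda>(s, c). \<chi> v. if v \<in> W then s *\<^sub>R rot90 (p $ v) + c else 0)"

lemma linear_motion_on: "linear (motion_on W p)"
  by (rule linearI) (auto simp: motion_on_def vec_eq_iff algebra_simps)

lemma subspace_range_motion_on: "subspace (range (motion_on W p))"
  by (intro linear_subspace_image linear_motion_on subspace_UNIV)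

lemma dim_range_motion_on_le: "dim (range (motion_on W p)) \<le> 3"
  using dim_image_le[OF linear_motion_on, of W p UNIV] by simp

text \<open>
  A motion that fixes two distinct points of the plane to first order is zero.
\<close>

lemma dim_range_motion_on:
  assumes "v \<in> W" "w \<in> W" "p $ v \<noteq> p $ w"
  shows "dim (range (motion_on W p)) = 3"
proof -
  have "inj (motion_on W p)"
    unfolding linear_injective_0[OF linear_motion_on]
  proof (intro allI impI)
    fix sc assume 0: "motion_on W p sc = 0"
    obtain s c where sc: "sc = (s, c)" by force
    from 0 have z: "s *\<^sub>R rot90 (p $ v) + c = 0" "s *\<^sub>R rot90 (p $ w) + c = 0"
      using assms(1,2) by (auto simp: motion_on_def sc vec_eq_iff split: if_splits)
    then have "s *\<^sub>R rot90 (p $ v) = s *\<^sub>R rot90 (p $ w)"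
      using add_right_cancel[of "s *\<^sub>R rot90 (p $ v)" c "s *\<^sub>R rot90 (p $ w)"] by presburger
    then have "s *\<^sub>R rot90 (p $ v - p $ w) = 0"
      by (simp add: scaleR_diff_right)
    moreover have "rot90 (p $ v - p $ w) \<noteq> 0"
      using assms(3) unfolding vec_eq_iff_2 by (auto simp del: rot90_simps)
    ultimately have "s = 0" by simp
    with z show "sc = 0" by (simp add: sc zero_prod_def)
  qed
  then show ?thesis
    using dim_image_eq[OF linear_motion_on, of W p UNIV] by simp
qed

lemma rigidity_row_inner_motion_on:
  assumes "v \<noteq> w" "{v, w} \<subseteq> W"
  shows "rigidity_row p {v, w} \<bullet> motion_on W p sc = 0"
proof -
  obtain s c where sc: "sc = (s, c)" by force
  have "rigidity_row p {v, w} \<bullet> motion_on W p sc = (p $ v - p $ w) \<bullet> (s *\<^sub>R rot90 (p $ v - p $ w))"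
    using assms by (simp add: rigidity_row_inner motion_on_def sc scaleR_diff_right)
  then show ?thesis
    by (simp del: rot90_simps)
qed

lemma dim_vectors_supported_on_le:
  "dim {z :: 'a::euclidean_space ^ 'v::finite. \<forall>u. u \<notin> W \<longrightarrow> z $ u = 0} \<le> card W * DIM('a)"
proof -
  let ?B = "\<Union>i\<in>W. axis i ` (Basis :: 'a set)"
  have "z \<in> span ?B" if z: "\<forall>u. u \<notin> W \<longrightarrow> z $ u = 0" for z :: "'a ^ 'v"
  proof -
    have axis: "axis i x \<in> span ?B" if "i \<in> W" for i and x :: 'a
    proof -
      have "linear (axis i :: 'a \<Rightarrow> 'a ^ 'v)"
        by (rule linearI) (auto simp: axis_def vec_eq_iff)
      then have "axis i x \<in> span (axis i ` (Basis :: 'a set))"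
        by (simp add: linear_span_image)
      then show ?thesis
        using span_mono[of "axis i ` Basis" ?B] that by blast
    qed
    have "z = (\<Sum>i\<in>W. axis i (z $ i))"
      using z by (auto simp: vec_eq_iff axis_def)
    with axis show ?thesis
      by (metis (no_types, lifting) span_sum)
  qed
  then have "dim {z :: 'a ^ 'v. \<forall>u. u \<notin> W \<longrightarrow> z $ u = 0} \<le> card ?B"
    by (intro dim_le_card) auto
  also have "\<dots> \<le> (\<Sum>i\<in>W. card (axis i ` (Basis :: 'a set) :: ('a ^ 'v) set))"
    by (intro card_UN_le) simp
  also have "\<dots> \<le> (\<Sum>i\<in>W. DIM('a))"
    by (intro sum_mono card_image_le) simp
  finally show ?thesis by simp
qed

lemma stress_free_edge_neq:
  assumes "stress_free x E" "{v, w} \<in> E" "v \<noteq> w"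
  shows "x $ v \<noteq> x $ w"
proof
  assume eq: "x $ v = x $ w"
  have "rigidity_row x {v, w} = 0"
    using assms(3) eq by (auto simp: rigidity_row_def vec_eq_iff scaleR_2)
  then have "(\<Sum>e\<in>E. (if e = {v, w} then 1 else 0) *\<^sub>R rigidity_row x e) = 0"
    by (intro sum.neutral) auto
  from stress_freeD[OF assms(1) this assms(2)] show False
    by simp
qed

text \<open>
  Vectors supported on \<open>W\<close> form a space of dimension at most \<open>2|W|\<close>. It contains the independent rows
  of the edges in \<open>F\<close> and, orthogonal to them, the three-dimensional space of rigid motions of \<open>W\<close>.
\<close>

lemma stress_free_plane_card_le:
  fixes p :: "(real ^ 2) ^ 'v::finite"
  assumes sg: "simple_graph W F" and sf: "stress_free p F" and "F \<noteq> {}"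
  shows "card F + 3 \<le> 2 * card W"
proof -
  let ?S = "{z :: (real ^ 2) ^ 'v. \<forall>u. u \<notin> W \<longrightarrow> z $ u = 0}"
  let ?A = "span (rigidity_row p ` F)"
  have edge: "\<exists>v w. e = {v, w} \<and> v \<noteq> w \<and> {v, w} \<subseteq> W" if "e \<in> F" for e
    using simple_graph_edgeE[OF sg that] sg that unfolding simple_graph_def by metis
  obtain e where "e \<in> F"
    using \<open>F \<noteq> {}\<close> by blast
  with edge[OF this] obtain v w where vw: "{v, w} \<in> F" "v \<noteq> w" "{v, w} \<subseteq> W"
    by blast
  have sub: "subspace ?S"
    by (auto simp: subspace_def)
  have "rigidity_row p ` F \<subseteq> ?S"
  proof (intro image_subsetI CollectI allI impI)
    fix e u assume "e \<in> F" "u \<notin> W"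
    then have "u \<notin> e" using edge by blast
    then show "rigidity_row p e $ u = 0"
      by (rule rigidity_row_nth_outside)
  qed
  then have "?A \<subseteq> ?S"
    using sub by (rule span_minimal)
  then have eq: "dim {y \<in> ?S. \<forall>x\<in>?A. orthogonal x y} + dim ?A = dim ?S"
    using sub by (intro dim_subspace_orthogonal_to_vectors) auto
  have "range (motion_on W p) \<subseteq> {y \<in> ?S. \<forall>x\<in>?A. orthogonal x y}"
  proof (intro image_subsetI CollectI conjI)
    fix sc show "\<forall>u. u \<notin> W \<longrightarrow> motion_on W p sc $ u = 0"
      by (auto simp: motion_on_def split: prod.split)
    have "motion_on W p sc \<in> flex_space F p"
      unfolding flex_space_def using edge rigidity_row_inner_motion_on by blast
    then show "\<forall>x\<in>?A. orthogonal x (motion_on W p sc)"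
      unfolding flex_space_eq_span by blast
  qed
  from dim_subset[OF this] have "3 \<le> dim {y \<in> ?S. \<forall>x\<in>?A. orthogonal x y}"
    using dim_range_motion_on[of v W w p] stress_free_edge_neq[OF sf vw(1,2)] vw(3) by simp
  moreover have "dim ?S \<le> 2 * card W"
    using dim_vectors_supported_on_le[of W, where 'a = "real ^ 2"] by simp
  ultimately show ?thesis
    using eq stress_free_imp_dim[OF sf] by simp
qed

lemma trivial_flex_plane_iff:
  "trivial_flex norm p z \<longleftrightarrow> z \<in> range (motion_on UNIV p)"
  unfolding trivial_flex_def infinitesimal_rigid_motions_plane motion_on_def by auto

lemma infinitesimally_rigid_plane_iff_subset:
  "bar_joint_framework E p \<Longrightarrow>
    infinitesimally_rigid norm E p \<longleftrightarrow> flex_space E p \<subseteq> range (motion_on UNIV p)"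
  by (auto simp: infinitesimally_rigid_def trivial_flex_plane_iff
      infinitesimal_flex_norm_iff_flex_space)

lemma infinitesimally_rigid_plane_rank_ge:
  fixes p :: "(real ^ 2) ^ 'v::finite"
  assumes "bar_joint_framework E p" "infinitesimally_rigid norm E p"
  shows "2 * CARD('v) \<le> dim (rigidity_row p ` E) + 3"
proof -
  have "dim (flex_space E p) \<le> 3"
    using assms(2) dim_subset[of "flex_space E p" "range (motion_on UNIV p)"]
      dim_range_motion_on_le[of UNIV p]
    unfolding infinitesimally_rigid_plane_iff_subset[OF assms(1)] by linarith
  then show ?thesis
    using dim_flex_space[of E p] by simp
qed

lemma infinitesimally_rigid_plane_iff_rank:
  fixes p :: "(real ^ 2) ^ 'v::finite"
  assumes fw: "bar_joint_framework E p" and "E \<noteq> {}"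
  shows "infinitesimally_rigid norm E p \<longleftrightarrow> dim (rigidity_row p ` E) + 3 = 2 * CARD('v)"
proof -
  have sg: "simple_graph UNIV E"
    using fw by (simp add: bar_joint_framework_def)
  have edge: "\<exists>v w. e = {v, w} \<and> v \<noteq> w" if "e \<in> E" for e
    using simple_graph_edgeE[OF sg that] by metis
  obtain e where "e \<in> E"
    using \<open>E \<noteq> {}\<close> by blast
  with edge[OF this] obtain v w where vw: "{v, w} \<in> E"
    by blast
  with fw have "p $ v \<noteq> p $ w"
    by (simp add: bar_joint_framework_def)
  then have dim: "dim (range (motion_on UNIV p)) = 3"
    by (intro dim_range_motion_on) auto
  have sub: "range (motion_on UNIV p) \<subseteq> flex_space E p"
    unfolding flex_space_def using edge rigidity_row_inner_motion_on by blast
  have "infinitesimally_rigid norm E p \<longleftrightarrow> dim (flex_space E p) = 3"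
  proof
    assume "infinitesimally_rigid norm E p"
    with sub have "flex_space E p = range (motion_on UNIV p)"
      by (simp add: infinitesimally_rigid_plane_iff_subset[OF fw])
    with dim show "dim (flex_space E p) = 3" by simp
  next
    assume "dim (flex_space E p) = 3"
    with dim have "range (motion_on UNIV p) = flex_space E p"
      by (intro subspace_dim_equal subspace_range_motion_on subspace_flex_space sub) simp
    then show "infinitesimally_rigid norm E p"
      by (simp add: infinitesimally_rigid_plane_iff_subset[OF fw])
  qed
  then show ?thesis
    using dim_flex_space[of E p] by auto
qed

text \<open>
  An edge whose row depends on the other rows could be deleted without changing the space of flexes.
\<close>

lemma minimally_rigid_imp_stress_free:
  assumes fw: "bar_joint_framework E p" and min: "minimally_infinitesimally_rigid norm E p"
  shows "stress_free p E"
proof (rule stress_free_if_notin_span, rule notI)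
  fix e assume e: "e \<in> E" and span: "rigidity_row p e \<in> span (rigidity_row p ` (E - {e}))"
  have "span (rigidity_row p ` E) = span (insert (rigidity_row p e) (rigidity_row p ` (E - {e})))"
    using e by (metis image_insert insert_Diff)
  also have "\<dots> = span (rigidity_row p ` (E - {e}))"
    by (rule span_redundant[OF span])
  finally have "flex_space E p = flex_space (E - {e}) p"
    by (simp add: flex_space_eq_span)
  then have "infinitesimally_rigid norm (E - {e}) p"
    using min bar_joint_framework_subset[OF fw, of "E - {e}"]
    by (simp add: minimally_infinitesimally_rigid_def infinitesimally_rigid_def
        infinitesimal_flex_norm_iff_flex_space fw)
  with e min show False
    by (simp add: minimally_infinitesimally_rigid_def)
qed

lemma minimally_infinitesimally_rigid_plane_iff:
  fixes p :: "(real ^ 2) ^ 'v::finite"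
  assumes fw: "bar_joint_framework E p" and n: "CARD('v) \<ge> 2"
  shows "minimally_infinitesimally_rigid norm E p \<longleftrightarrow>
    dim (rigidity_row p ` E) = card E \<and> card E + 3 = 2 * CARD('v)"
proof
  assume min: "minimally_infinitesimally_rigid norm E p"
  then have rigid: "infinitesimally_rigid norm E p"
    by (simp add: minimally_infinitesimally_rigid_def)
  have "E \<noteq> {}"
    using infinitesimally_rigid_plane_rank_ge[OF fw rigid] n by auto
  with rigid have "dim (rigidity_row p ` E) + 3 = 2 * CARD('v)"
    by (simp add: infinitesimally_rigid_plane_iff_rank[OF fw])
  moreover have "dim (rigidity_row p ` E) = card E"
    by (intro stress_free_imp_dim minimally_rigid_imp_stress_free[OF fw min])
  ultimately show "dim (rigidity_row p ` E) = card E \<and> card E + 3 = 2 * CARD('v)"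
    by simp
next
  assume *: "dim (rigidity_row p ` E) = card E \<and> card E + 3 = 2 * CARD('v)"
  then have "E \<noteq> {}" by (auto dest: arg_cong[where f = even])
  with * have "infinitesimally_rigid norm E p"
    by (simp add: infinitesimally_rigid_plane_iff_rank[OF fw])
  moreover have "\<not> infinitesimally_rigid norm (E - {e}) p" if e: "e \<in> E" for e
  proof
    assume "infinitesimally_rigid norm (E - {e}) p"
    then have "2 * CARD('v) \<le> dim (rigidity_row p ` (E - {e})) + 3"
      by (intro infinitesimally_rigid_plane_rank_ge bar_joint_framework_subset[OF fw]) auto
    also have "\<dots> \<le> card (E - {e}) + 3"
      using dim_rigidity_row_le by auto
    also have "\<dots> < card E + 3"
      using card_Diff1_less[OF _ e] by simp
    finally show False
      using * by simp
  qed
  ultimately show "minimally_infinitesimally_rigid norm E p"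
    by (simp add: minimally_infinitesimally_rigid_def)
qed


section \<open>Perturbation to general position\<close>

text \<open>
  The map that sends coefficients \<open>\<omega>\<close> on the edges to \<open>\<Sum>\<omega>\<^sub>e\<close> times the row of \<open>e\<close> is injective at
  \<open>x\<close>, hence bounded below by \<open>c * norm \<omega>\<close>. Since rows are linear in the placement, moving \<open>x\<close> by
  \<open>t *\<^sub>R m\<close> changes it by at most \<open>\<bar>t\<bar> * K * norm \<omega>\<close>, which is too little to reach zero when
  \<open>\<bar>t\<bar> * K < c\<close>.
\<close>

lemma stress_free_eventually:
  fixes x m :: "'a::euclidean_space ^ 'v::finite"
  assumes sf: "stress_free x E"
  shows "\<forall>\<^sub>F t in at 0. stress_free (x + t *\<^sub>R m) E"
proof -
  define S :: "'a ^ 'v \<Rightarrow> real ^ 'v set \<Rightarrow> 'a ^ 'v"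
    where "S = (\<lambda>y \<omega>. \<Sum>e\<in>E. (\<omega> $ e) *\<^sub>R rigidity_row y e)"
  let ?U = "{\<omega> :: real ^ 'v set. \<forall>e. e \<notin> E \<longrightarrow> \<omega> $ e = 0}"
  have lin: "linear (S y)" for y
    unfolding S_def by (rule linearI) (simp_all add: scaleR_add_left sum.distrib scaleR_sum_right)
  then have blin: "bounded_linear (S y)" for y
    by (simp add: linear_conv_bounded_linear)
  have S_add: "S (x + t *\<^sub>R m) \<omega> = S x \<omega> + t *\<^sub>R S m \<omega>" for t \<omega>
    by (simp add: S_def rigidity_row_add scaleR_add_right sum.distrib scaleR_sum_right mult.commute)
  have sub: "subspace ?U"
    by (auto simp: subspace_def)
  have "\<forall>\<omega>\<in>?U. S x \<omega> = 0 \<longrightarrow> \<omega> = 0"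
    unfolding S_def using stress_freeD[OF sf] by (fastforce simp: vec_eq_iff)
  then obtain c where c: "c > 0" "\<And>\<omega>. \<omega> \<in> ?U \<Longrightarrow> norm (S x \<omega>) \<ge> c * norm \<omega>"
    using injective_imp_isometric[OF closed_subspace[OF sub] sub blin[of x]] by blast
  obtain K where K: "K > 0" "\<And>\<omega>. norm (S m \<omega>) \<le> norm \<omega> * K"
    using bounded_linear.pos_bounded[OF blin[of m]] by blast
  show ?thesis
    unfolding eventually_at
  proof (intro exI[of _ "c / K"] conjI ballI impI)
    show "0 < c / K" using c K by simp
    fix t :: real assume "t \<noteq> 0 \<and> dist t 0 < c / K"
    then have t: "\<bar>t\<bar> * K < c"
      using K(1) by (simp add: field_simps)
    show "stress_free (x + t *\<^sub>R m) E"
      unfolding stress_free_def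
    proof (intro allI impI ballI)
      fix \<omega> e assume sum: "(\<Sum>e\<in>E. \<omega> e *\<^sub>R rigidity_row (x + t *\<^sub>R m) e) = 0" and "e \<in> E"
      define w :: "real ^ 'v set" where "w = (\<chi> e. if e \<in> E then \<omega> e else 0)"
      have "S (x + t *\<^sub>R m) w = 0"
        using sum by (simp add: S_def w_def)
      then have "S x w = - (t *\<^sub>R S m w)"
        unfolding S_add by (simp add: eq_neg_iff_add_eq_0)
      then have "c * norm w \<le> \<bar>t\<bar> * norm (S m w)"
        using c(2)[of w] by (simp add: w_def)
      also have "\<dots> \<le> \<bar>t\<bar> * (norm w * K)"
        by (intro mult_left_mono K) simp
      finally have "(c - \<bar>t\<bar> * K) * norm w \<le> 0"
        by (simp add: algebra_simps)
      with t have "norm w \<le> 0"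
        by (simp add: mult_le_0_iff)
      then have "w $ e = 0" by simp
      with \<open>e \<in> E\<close> show "\<omega> e = 0" by (simp add: w_def)
    qed
  qed
qed

definition general_position :: "(real ^ 2) ^ 'v::finite \<Rightarrow> bool" where
  "general_position x \<longleftrightarrow>
     (\<forall>u v. u \<noteq> v \<longrightarrow> x $ u \<noteq> x $ v) \<and>
     (\<forall>u v w. distinct [u, v, w] \<longrightarrow> rot90 (x $ v - x $ u) \<bullet> (x $ w - x $ u) \<noteq> 0)"

lemma eventually_poly_neq_0:
  fixes q :: "real poly"
  assumes "q \<noteq> 0"
  shows "\<forall>\<^sub>F t in at a. poly q t \<noteq> 0"
proof -
  have "finite {t. poly q t = 0}"
    using assms by (rule poly_roots_finite)
  from islimpt_finite[OF this, of a] show ?thesis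
    unfolding islimpt_iff_eventually by simp
qed

text \<open>
  Moving the vertices in the directions \<open>(n, n\<^sup>2)\<close> of distinct points of a parabola works: the cross
  product that tests a triple for collinearity becomes a quadratic polynomial in \<open>t\<close>, whose leading
  coefficient is a Vandermonde determinant and hence non-zero. Such a polynomial has finitely many
  roots.
\<close>

lemma eventually_general_position:
  obtains m :: "(real ^ 2) ^ 'v::finite"
  where "\<And>x. \<forall>\<^sub>F t in at 0. general_position (x + t *\<^sub>R m)"
proof -
  obtain n :: "'v \<Rightarrow> nat" where inj: "inj n"
    using finite_imp_inj_to_nat_seg[of "UNIV :: 'v set"] by auto
  define m :: "(real ^ 2) ^ 'v" where "m = (\<chi> v. vector [real (n v), (real (n v))\<^sup>2])"
  have "\<forall>\<^sub>F t in at 0. general_position (x + t *\<^sub>R m)" for x :: "(real ^ 2) ^ 'v"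
  proof -
    have 1: "\<forall>\<^sub>F t in at 0. u \<noteq> v \<longrightarrow> (x + t *\<^sub>R m) $ u \<noteq> (x + t *\<^sub>R m) $ v" for u v
    proof (cases "u = v")
      case False
      let ?q = "[:(x $ u - x $ v) $ 1, real (n u) - real (n v):]"
      have "?q \<noteq> 0"
        using inj False by (auto dest: injD)
      then have "\<forall>\<^sub>F t in at 0. poly ?q t \<noteq> 0"
        by (rule eventually_poly_neq_0)
      then show ?thesis
        by eventually_elim (auto simp: m_def vec_eq_iff_2 algebra_simps)
    qed simp
    have 2: "\<forall>\<^sub>F t in at 0. distinct [u, v, w] \<longrightarrow>
      rot90 ((x + t *\<^sub>R m) $ v - (x + t *\<^sub>R m) $ u) \<bullet> ((x + t *\<^sub>R m) $ w - (x + t *\<^sub>R m) $ u) \<noteq> 0" for u v w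
    proof (cases "distinct [u, v, w]")
      case True
      define C where "C = rot90 (m $ v - m $ u) \<bullet> (m $ w - m $ u)"
      let ?q = "[:rot90 (x $ v - x $ u) \<bullet> (x $ w - x $ u),
        rot90 (x $ v - x $ u) \<bullet> (m $ w - m $ u) + rot90 (m $ v - m $ u) \<bullet> (x $ w - x $ u), C:]"
      have "C = (real (n v) - real (n u)) * (real (n w) - real (n u)) * (real (n w) - real (n v))"
        unfolding C_def inner_real2 rot90_nth m_def by (simp add: power2_eq_square) algebra
      then have "C \<noteq> 0"
        using inj True by (auto dest: injD)
      then have "?q \<noteq> 0" by simp
      then have ev: "\<forall>\<^sub>F t in at 0. poly ?q t \<noteq> 0"
        by (rule eventually_poly_neq_0)
      have "rot90 ((x + t *\<^sub>R m) $ v - (x + t *\<^sub>R m) $ u) \<bullet>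
          ((x + t *\<^sub>R m) $ w - (x + t *\<^sub>R m) $ u) = poly ?q t" for t
        unfolding C_def inner_real2 by (simp del: rot90_simps) algebra
      then show ?thesis
        using ev by (auto elim: eventually_mono)
    qed auto
    show ?thesis
      unfolding general_position_def by (intro eventually_conj eventually_all_finite 1 2)
  qed
  then show thesis by (rule that)
qed

lemma stress_free_general_position:
  fixes x :: "(real ^ 2) ^ 'v::finite"
  assumes "stress_free x E"
  obtains y :: "(real ^ 2) ^ 'v" where "stress_free y E" "general_position y"
proof -
  obtain m :: "(real ^ 2) ^ 'v" where "\<forall>\<^sub>F t in at 0. general_position (x + t *\<^sub>R m)"
    using eventually_general_position by metis
  with stress_free_eventually[OF assms, of m]
  have "\<forall>\<^sub>F t in at 0. stress_free (x + t *\<^sub>R m) E \<and> general_position (x + t *\<^sub>R m)"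
    by (rule eventually_conj)
  then show thesis
    using that eventually_happens[of _ "at (0::real)"] by auto
qed

section \<open>Henneberg extensions\<close>

lemma stress_at_vertex:
  assumes "(\<Sum>e\<in>E. \<omega> e *\<^sub>R rigidity_row x e) = 0"
  shows "(\<Sum>e\<in>{e \<in> E. v \<in> e}. \<omega> e *\<^sub>R rigidity_row x e $ v) = 0"
proof -
  have "(\<Sum>e\<in>{e \<in> E. v \<in> e}. \<omega> e *\<^sub>R rigidity_row x e $ v) = (\<Sum>e\<in>E. \<omega> e *\<^sub>R rigidity_row x e $ v)"
    by (intro sum.mono_neutral_left) (auto simp: rigidity_row_nth_outside)
  also have "\<dots> = (\<Sum>e\<in>E. \<omega> e *\<^sub>R rigidity_row x e) $ v"
    by simp
  finally show ?thesis
    using assms by simp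
qed

text \<open>
  At \<open>v\<close> a stress is a linear relation between at most two edge directions. These are independent by
  general position, so the stress vanishes on the edges at \<open>v\<close> and is a stress of the rest.
\<close>

lemma stress_free_zero_extension:
  fixes x :: "(real ^ 2) ^ 'v::finite"
  assumes sg: "simple_graph UNIV E" and gp: "general_position x"
    and deg: "card {e \<in> E. v \<in> e} \<le> 2"
    and sf: "stress_free x (E - {e \<in> E. v \<in> e})"
  shows "stress_free x E"
  unfolding stress_free_def
proof (intro allI impI)
  fix \<omega> assume sum: "(\<Sum>e\<in>E. \<omega> e *\<^sub>R rigidity_row x e) = 0"
  let ?D = "{e \<in> E. v \<in> e}"
  note at_v = stress_at_vertex[OF sum, of v]
  have edge: "\<exists>a. e = {v, a} \<and> a \<noteq> v" if "e \<in> ?D" for e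
    using that simple_graph_edgeE[OF sg, of e] by (auto simp: insert_commute)
  have D: "\<forall>e\<in>?D. \<omega> e = 0"
  proof -
    consider "card ?D = 0" | "card ?D = 1" | "card ?D = 2"
      using deg by linarith
    then show ?thesis
    proof cases
      case 1
      then have "?D = {}" by simp
      then show ?thesis by blast
    next
      case 2
      then obtain e where e: "?D = {e}" by (auto simp: card_1_singleton_iff)
      with edge obtain a where "e = {v, a}" "a \<noteq> v" by blast
      with at_v[unfolded e] gp show ?thesis
        unfolding e by (simp add: rigidity_row_nth_edge general_position_def)
    next
      case 3
      then obtain e f where ef: "?D = {e, f}" "e \<noteq> f" by (auto simp: card_2_iff)
      then obtain a b where a: "e = {v, a}" "a \<noteq> v" and b: "f = {v, b}" "b \<noteq> v"
        using edge[of e] edge[of f] by blast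
      with ef(2) have "a \<noteq> b" by auto
      have eq: "\<omega> e *\<^sub>R (x $ v - x $ a) + \<omega> f *\<^sub>R (x $ v - x $ b) = 0"
        using at_v[unfolded ef(1)] ef(2) a b by (simp add: rigidity_row_nth_edge)
      \<comment> \<open>The cross product with \<open>x $ v - x $ b\<close> eliminates the term of \<open>f\<close>.\<close>
      have "\<omega> e * (rot90 (x $ b - x $ v) \<bullet> (x $ a - x $ v)) =
          rot90 (x $ v - x $ b) \<bullet> (\<omega> e *\<^sub>R (x $ v - x $ a) + \<omega> f *\<^sub>R (x $ v - x $ b))"
        unfolding inner_real2 by (simp add: algebra_simps)
      also have "\<dots> = 0" unfolding eq by simp
      finally have "\<omega> e = 0"
        using gp a b \<open>a \<noteq> b\<close> unfolding general_position_def by force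
      moreover from this eq have "\<omega> f = 0"
        using gp b(2) unfolding general_position_def by auto
      ultimately show ?thesis unfolding ef(1) by simp
    qed
  qed
  have "(\<Sum>e\<in>E. \<omega> e *\<^sub>R rigidity_row x e) = (\<Sum>e\<in>E - ?D. \<omega> e *\<^sub>R rigidity_row x e)"
    using D by (intro sum.mono_neutral_right) auto
  with sum have "(\<Sum>e\<in>E - ?D. \<omega> e *\<^sub>R rigidity_row x e) = 0"
    by simp
  from stress_freeD[OF sf this] D show "\<forall>e\<in>E. \<omega> e = 0"
    by blast
qed

lemma rigidity_row_cong:
  assumes "\<And>u. u \<in> e \<Longrightarrow> x $ u = y $ u"
  shows "rigidity_row x e = rigidity_row y e"
  using assms by (simp add: rigidity_row_def vec_eq_iff cong: sum.cong)

text \<open>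
  The new vertex \<open>v\<close> is put at the midpoint of \<open>a\<close> and \<open>b\<close>; the line through these points misses
  \<open>c\<close> by general position. Equilibrium at \<open>v\<close> then forces the coefficient of \<open>{v, c}\<close> to be zero and those of
  \<open>{v, a}\<close> and \<open>{v, b}\<close> to be equal, and two collinear edges with equal coefficients act on \<open>a\<close> and \<open>b\<close>
  like one edge \<open>{a, b}\<close> with half the coefficient. So a stress of the extension gives one of the
  original graph.
\<close>

lemma stress_free_one_extension:
  fixes x :: "(real ^ 2) ^ 'v::finite"
  assumes dist: "distinct [v, a, b, c]" and F: "\<And>e. e \<in> F \<Longrightarrow> v \<notin> e" "{a, b} \<notin> F"
    and gp: "general_position x" and sf: "stress_free x (insert {a, b} F)"
  obtains y :: "(real ^ 2) ^ 'v" where "stress_free y (F \<union> {{v, a}, {v, b}, {v, c}})"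
proof
  define y where "y = (\<chi> u. if u = v then (1 / 2) *\<^sub>R (x $ a + x $ b) else x $ u)"
  define d where "d = x $ b - x $ a"
  have y: "y $ a = x $ a" "y $ b = x $ b" "y $ c = x $ c" "y $ v = x $ a + (1 / 2) *\<^sub>R d"
    using dist by (auto simp: y_def d_def vec_eq_iff field_simps)
  have d0: "d \<noteq> 0" and nc: "rot90 d \<bullet> (x $ c - x $ a) \<noteq> 0"
    using gp dist by (auto simp: general_position_def d_def simp del: rot90_simps)
  show "stress_free y (F \<union> {{v, a}, {v, b}, {v, c}})"
    unfolding stress_free_def
  proof (intro allI impI)
    fix \<omega> assume sum: "(\<Sum>e\<in>F \<union> {{v, a}, {v, b}, {v, c}}. \<omega> e *\<^sub>R rigidity_row y e) = 0"
    define \<alpha> \<beta> \<gamma> where "\<alpha> = \<omega> {v, a}" and "\<beta> = \<omega> {v, b}" and "\<gamma> = \<omega> {v, c}"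
    have neq: "{v, a} \<noteq> {v, b}" "{v, a} \<noteq> {v, c}" "{v, b} \<noteq> {v, c}"
      using dist by (auto simp: doubleton_eq_iff)
    have D: "{e \<in> F \<union> {{v, a}, {v, b}, {v, c}}. v \<in> e} = {{v, a}, {v, b}, {v, c}}"
      using F(1) by auto
    have "\<alpha> *\<^sub>R (y $ v - y $ a) + \<beta> *\<^sub>R (y $ v - y $ b) + \<gamma> *\<^sub>R (y $ v - y $ c) = 0"
      using stress_at_vertex[OF sum, of v, unfolded D] neq dist
      by (simp add: rigidity_row_nth_edge \<alpha>_def \<beta>_def \<gamma>_def add.assoc)
    then have eq: "((\<alpha> - \<beta>) / 2) *\<^sub>R d + \<gamma> *\<^sub>R (y $ v - x $ c) = 0"
      by (simp add: y d_def vec_eq_iff field_simps)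
    have "rot90 d \<bullet> (y $ v - x $ c) = - (rot90 d \<bullet> (x $ c - x $ a))"
      by (simp add: y inner_diff_right inner_add_right)
    moreover have "rot90 d \<bullet> (((\<alpha> - \<beta>) / 2) *\<^sub>R d + \<gamma> *\<^sub>R (y $ v - x $ c)) = \<gamma> * (rot90 d \<bullet> (y $ v - x $ c))"
      by (simp add: inner_add_right)
    ultimately have \<gamma>: "\<gamma> = 0"
      using eq nc by simp
    with eq d0 have \<beta>: "\<beta> = \<alpha>" by simp
    have merge: "rigidity_row y {v, a} + rigidity_row y {v, b} = (1 / 2) *\<^sub>R rigidity_row x {a, b}"
    proof (rule vec_eq_iff[THEN iffD2, rule_format])
      fix u
      consider "u = v" | "u = a" | "u = b" | "u \<notin> {v, a, b}" by blast
      then show "(rigidity_row y {v, a} + rigidity_row y {v, b}) $ u = ((1 / 2) *\<^sub>R rigidity_row x {a, b}) $ u"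
        by cases (use dist in \<open>auto simp: rigidity_row_nth_edge rigidity_row_nth_outside y d_def
            vec_eq_iff field_simps\<close>)
    qed
    define \<omega>' where "\<omega>' e = (if e = {a, b} then \<alpha> / 2 else \<omega> e)" for e
    have "0 = (\<Sum>e\<in>F. \<omega> e *\<^sub>R rigidity_row y e) + \<alpha> *\<^sub>R (rigidity_row y {v, a} + rigidity_row y {v, b})"
      using sum neq F(1) \<beta> \<gamma>
      by (subst (asm) sum.union_disjoint) (auto simp: \<alpha>_def \<beta>_def \<gamma>_def scaleR_add_right)
    also have "(\<Sum>e\<in>F. \<omega> e *\<^sub>R rigidity_row y e) = (\<Sum>e\<in>F. \<omega>' e *\<^sub>R rigidity_row x e)"
    proof (rule sum.cong[OF refl])
      fix e assume e: "e \<in> F"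
      then have "rigidity_row y e = rigidity_row x e"
        using F(1) by (intro rigidity_row_cong) (auto simp: y_def)
      then show "\<omega> e *\<^sub>R rigidity_row y e = \<omega>' e *\<^sub>R rigidity_row x e"
        using e F(2) by (auto simp: \<omega>'_def)
    qed
    also have "\<alpha> *\<^sub>R (rigidity_row y {v, a} + rigidity_row y {v, b}) = \<omega>' {a, b} *\<^sub>R rigidity_row x {a, b}"
      by (simp add: merge \<omega>'_def)
    finally have "(\<Sum>e\<in>insert {a, b} F. \<omega>' e *\<^sub>R rigidity_row x e) = 0"
      using F(2) by (simp add: add.commute)
    note \<omega>' = stress_freeD[OF sf this]
    from \<omega>'[of "{a, b}"] have "\<alpha> = 0"
      by (simp add: \<omega>'_def)
    moreover have "\<omega> e = 0" if "e \<in> F" for e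
      using \<omega>'[of e] that F(2) by (auto simp: \<omega>'_def split: if_splits)
    ultimately show "\<forall>e\<in>F \<union> {{v, a}, {v, b}, {v, c}}. \<omega> e = 0"
      using \<beta> \<gamma> by (auto simp: \<alpha>_def \<beta>_def \<gamma>_def)
  qed
qed


section \<open>Sparse graphs\<close>

text \<open>
  The sparsity half of the Laman condition, tested on induced subgraphs, which have the most edges on
  a given vertex set. Moving the 3 to the left avoids truncated subtraction.
\<close>

definition laman_sparse :: "'v::finite set set \<Rightarrow> bool" where
  "laman_sparse E \<longleftrightarrow> (\<forall>W. card W \<ge> 2 \<longrightarrow> card {e \<in> E. e \<subseteq> W} + 3 \<le> 2 * card W)"

lemma laman_sparse_subset:
  assumes "laman_sparse E" "F \<subseteq> E"
  shows "laman_sparse F"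
  unfolding laman_sparse_def
proof (intro allI impI)
  fix W :: "'a set" assume "2 \<le> card W"
  then have "card {e \<in> E. e \<subseteq> W} + 3 \<le> 2 * card W"
    using assms(1) by (simp add: laman_sparse_def)
  moreover have "card {e \<in> F. e \<subseteq> W} \<le> card {e \<in> E. e \<subseteq> W}"
    using assms(2) by (intro card_mono) auto
  ultimately show "card {e \<in> F. e \<subseteq> W} + 3 \<le> 2 * card W"
    by simp
qed

lemma sum_degree_eq:
  fixes E :: "'v::finite set set"
  assumes sg: "simple_graph UNIV E"
  shows "(\<Sum>v\<in>\<Union>E. card {e \<in> E. v \<in> e}) = 2 * card E"
proof -
  have "(\<Sum>v\<in>\<Union>E. card {e \<in> E. v \<in> e}) = (\<Sum>v\<in>\<Union>E. \<Sum>e\<in>E. if v \<in> e then 1 else 0)"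
    by (intro sum.cong refl) (simp add: sum.If_cases Int_def)
  also have "\<dots> = (\<Sum>e\<in>E. \<Sum>v\<in>\<Union>E. if v \<in> e then 1 else 0)"
    by (rule sum.swap)
  also have "\<dots> = (\<Sum>e\<in>E. card e)"
  proof (rule sum.cong[OF refl])
    fix e assume "e \<in> E"
    then have "\<Union>E \<inter> {v. v \<in> e} = e" by auto
    then show "(\<Sum>v\<in>\<Union>E. if v \<in> e then 1 else 0) = card e"
      by (simp add: sum.If_cases)
  qed
  also have "\<dots> = (\<Sum>e\<in>E. 2)"
    using sg by (intro sum.cong) (auto simp: simple_graph_def)
  finally show ?thesis by simp
qed

text \<open>
  The degrees sum to \<open>2|E|\<close>, which is at most \<open>4|W| - 6\<close> for the set \<open>W\<close> of non-isolated vertices, so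
  not all degrees in \<open>W\<close> can be 4 or more.
\<close>

lemma laman_sparse_low_degree_vertex:
  fixes E :: "'v::finite set set"
  assumes sg: "simple_graph UNIV E" and sp: "laman_sparse E" and "E \<noteq> {}"
  obtains v where "v \<in> \<Union>E" "card {e \<in> E. v \<in> e} \<le> 3"
proof -
  obtain e where e: "e \<in> E" using \<open>E \<noteq> {}\<close> by blast
  then have "card e \<le> card (\<Union>E)"
    by (intro card_mono) auto
  then have "2 \<le> card (\<Union>E)"
    using sg e by (auto simp: simple_graph_def)
  then have "card {e \<in> E. e \<subseteq> \<Union>E} + 3 \<le> 2 * card (\<Union>E)"
    using sp by (simp add: laman_sparse_def)
  moreover have "{e \<in> E. e \<subseteq> \<Union>E} = E" by auto
  ultimately have count: "card E + 3 \<le> 2 * card (\<Union>E)" by simp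
  have "\<exists>v\<in>\<Union>E. card {e \<in> E. v \<in> e} \<le> 3"
  proof (rule ccontr)
    assume "\<not> ?thesis"
    then have "(\<Sum>v\<in>\<Union>E. 4) \<le> (\<Sum>v\<in>\<Union>E. card {e \<in> E. v \<in> e})"
      by (intro sum_mono) force
    then have "4 * card (\<Union>E) \<le> 2 * card E"
      by (simp add: sum_degree_eq[OF sg])
    with count show False by simp
  qed
  then show thesis using that by blast
qed

text \<open>
  If adding the edge between two neighbours of \<open>v\<close> always failed, each pair of neighbours would lie in
  a dense set, that is, a vertex set without \<open>v\<close> that spans at least \<open>2|W| - 3\<close> edges. No dense set can
  contain all three neighbours, because \<open>v\<close> together with its three edges would violate sparsity. By
  supermodularity of the edge count, the union of two dense sets that meet in at least two vertices is
  dense; so the three dense sets pairwise meet in a single neighbour. But then they share no edges, and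
  their union is dense by counting: it spans at least \<open>(2|A| - 3) + (2|B| - 3) + (2|C| - 3)\<close> edges and
  has \<open>|A| + |B| + |C| - 3\<close> vertices. This union contains all three neighbours, a contradiction.
\<close>

lemma laman_sparse_reverse_one_extension:
  fixes F :: "'v::finite set set"
  assumes sg: "simple_graph UNIV F" and F: "\<And>e. e \<in> F \<Longrightarrow> v \<notin> e"
    and dist: "distinct [v, a, b, c]"
    and sp: "laman_sparse (F \<union> {{v, a}, {v, b}, {v, c}})"
  shows "\<exists>a' b' c'. {a', b', c'} = {a, b, c} \<and> distinct [a', b', c'] \<and>
    {a', b'} \<notin> F \<and> laman_sparse (insert {a', b'} F)"
proof (rule ccontr)
  assume no_pair: "\<not> ?thesis"
  define i where "i W = card {e \<in> F. e \<subseteq> W}" for W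
  define dense where "dense W \<longleftrightarrow> v \<notin> W \<and> 2 * card W \<le> i W + 3" for W
  have spF: "i W + 3 \<le> 2 * card W" if "card W \<ge> 2" for W
    using laman_sparse_subset[OF sp, of F] that by (auto simp: laman_sparse_def i_def)
  have not_abc: False if W: "dense W" "{a, b, c} \<subseteq> W" for W
  proof -
    have vW: "v \<notin> W" using W(1) by (simp add: dense_def)
    have "card {a, b, c} \<le> card W"
      using W(2) by (intro card_mono) auto
    then have card: "card (insert v W) \<ge> 2" "card (insert v W) = card W + 1"
      using dist vW by auto
    have "{e \<in> F. e \<subseteq> W} \<union> {{v, a}, {v, b}, {v, c}} \<subseteq>
        {e \<in> F \<union> {{v, a}, {v, b}, {v, c}}. e \<subseteq> insert v W}"
      using W(2) by auto
    then have "card ({e \<in> F. e \<subseteq> W} \<union> {{v, a}, {v, b}, {v, c}}) \<le>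
        card {e \<in> F \<union> {{v, a}, {v, b}, {v, c}}. e \<subseteq> insert v W}"
      by (intro card_mono) auto
    also have "card ({e \<in> F. e \<subseteq> W} \<union> {{v, a}, {v, b}, {v, c}}) = i W + card {{v, a}, {v, b}, {v, c}}"
      unfolding i_def using F by (intro card_Un_disjoint) auto
    also have "card {{v, a}, {v, b}, {v, c}} = 3"
      using dist by (simp add: doubleton_eq_iff)
    finally have "i W + 3 + 3 \<le> 2 * card (insert v W)"
      using sp card(1) unfolding laman_sparse_def by (meson add_le_mono1 le_trans)
    with card(2) W(1) show False
      by (simp add: dense_def)
  qed
  have dense_pair: "\<exists>W. dense W \<and> {q, r} \<subseteq> W"
    if qr: "{q, r, s} = {a, b, c}" "distinct [q, r, s]" for q r s
  proof -
    \<comment> \<open>If the edge is already present, its two ends form a dense set.\<close>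
    from no_pair qr consider "{q, r} \<in> F" | "\<not> laman_sparse (insert {q, r} F)"
      by blast
    then show ?thesis
    proof cases
      case 1
      then have "{{q, r}} \<subseteq> {e \<in> F. e \<subseteq> {q, r}}" by auto
      then have "card {{q, r}} \<le> i {q, r}"
        unfolding i_def by (intro card_mono) auto
      then have "dense {q, r}"
        using F[OF 1] qr(2) by (simp add: dense_def)
      then show ?thesis by blast
    next
      case 2
      then obtain W where W: "card W \<ge> 2" "2 * card W < card {e \<in> insert {q, r} F. e \<subseteq> W} + 3"
        unfolding laman_sparse_def by (meson not_le)
      have sub: "{q, r} \<subseteq> W"
      proof (rule ccontr)
        assume "\<not> {q, r} \<subseteq> W"
        then have "{e \<in> insert {q, r} F. e \<subseteq> W} = {e \<in> F. e \<subseteq> W}" by auto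
        with W spF[OF W(1)] show False by (simp add: i_def)
      qed
      have "{e \<in> insert {q, r} F. e \<subseteq> W} \<subseteq> insert {q, r} {e \<in> F. e \<subseteq> W}" by auto
      then have "card {e \<in> insert {q, r} F. e \<subseteq> W} \<le> card (insert {q, r} {e \<in> F. e \<subseteq> W})"
        by (intro card_mono) auto
      also have "\<dots> \<le> i W + 1"
        unfolding i_def using card_insert_le_m1 by (simp add: card_insert_if)
      finally have "2 * card W \<le> i W + 3"
        using W(2) by simp
      moreover have "{e \<in> F. e \<subseteq> W - {v}} = {e \<in> F. e \<subseteq> W}"
        using F by auto
      then have "i (W - {v}) = i W" by (simp add: i_def)
      moreover have "card (W - {v}) \<le> card W"
        by (intro card_mono) auto
      ultimately have "dense (W - {v})"
        by (simp add: dense_def)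
      moreover have "{q, r} \<subseteq> W - {v}"
        using sub qr dist by auto
      ultimately show ?thesis by blast
    qed
  qed
  have supermodular: "i A + i B \<le> i (A \<union> B) + i (A \<inter> B)" for A B
  proof -
    have "i A + i B = card ({e \<in> F. e \<subseteq> A} \<union> {e \<in> F. e \<subseteq> B}) + card ({e \<in> F. e \<subseteq> A} \<inter> {e \<in> F. e \<subseteq> B})"
      unfolding i_def by (rule card_Un_Int) auto
    moreover have "{e \<in> F. e \<subseteq> A} \<inter> {e \<in> F. e \<subseteq> B} = {e \<in> F. e \<subseteq> A \<inter> B}" by auto
    moreover have "card ({e \<in> F. e \<subseteq> A} \<union> {e \<in> F. e \<subseteq> B}) \<le> i (A \<union> B)"
      unfolding i_def by (intro card_mono) auto
    ultimately show ?thesis by (simp add: i_def)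
  qed
  have meet: "A \<inter> B = {q}" if AB: "dense A" "dense B" "q \<in> A" "q \<in> B" "{a, b, c} \<subseteq> A \<union> B" for A B q
  proof (rule ccontr)
    assume ne: "A \<inter> B \<noteq> {q}"
    have "q \<in> A \<inter> B" using AB(3,4) by simp
    then have "card (A \<inter> B) \<noteq> 0" by auto
    moreover have "card (A \<inter> B) \<noteq> 1"
    proof
      assume "card (A \<inter> B) = 1"
      then obtain x where "A \<inter> B = {x}" by (rule card_1_singletonE)
      with \<open>q \<in> A \<inter> B\<close> ne show False by (metis singletonD)
    qed
    ultimately have "i (A \<inter> B) + 3 \<le> 2 * card (A \<inter> B)"
      by (intro spF) linarith
    moreover have "card A + card B = card (A \<union> B) + card (A \<inter> B)"
      by (rule card_Un_Int) auto
    ultimately have "dense (A \<union> B)"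
      using AB(1,2) supermodular[of A B] by (simp add: dense_def)
    with AB(5) show False using not_abc by blast
  qed
  obtain A where A: "dense A" "{a, b} \<subseteq> A" using dense_pair[of a b c] dist by auto
  obtain B where B: "dense B" "{b, c} \<subseteq> B" using dense_pair[of b c a] dist by auto
  obtain C where C: "dense C" "{c, a} \<subseteq> C" using dense_pair[of c a b] dist by auto
  have AB: "A \<inter> B = {b}" and BC: "B \<inter> C = {c}" and CA: "C \<inter> A = {a}"
    using meet[of A B b] meet[of B C c] meet[of C A a] A B C by auto
  have no_loop: "\<not> (e \<subseteq> {q})" if "e \<in> F" for e q
  proof
    assume "e \<subseteq> {q}"
    then have "card e \<le> card {q}" by (intro card_mono) auto
    with sg that show False by (simp add: simple_graph_def)
  qed
  have disj: "{e \<in> F. e \<subseteq> X} \<inter> {e \<in> F. e \<subseteq> Y} = {}" if "X \<inter> Y = {q}" for X Y q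
    using no_loop[of _ q] that by blast
  have "i A + i B + i C = card ({e \<in> F. e \<subseteq> A} \<union> {e \<in> F. e \<subseteq> B} \<union> {e \<in> F. e \<subseteq> C})"
    using disj[OF AB] disj[OF BC] disj[OF CA] unfolding i_def
    by (subst card_Un_disjoint; (subst card_Un_disjoint)?) auto
  also have "\<dots> \<le> i (A \<union> B \<union> C)"
    unfolding i_def by (intro card_mono) auto
  finally have edges: "i A + i B + i C \<le> i (A \<union> B \<union> C)" .
  have "card A + card B = card (A \<union> B) + 1"
    using card_Un_Int[of A B] AB by simp
  moreover have "(A \<union> B) \<inter> C = {a, c}"
    using BC CA by auto
  then have "card (A \<union> B) + card C = card (A \<union> B \<union> C) + 2"
    using card_Un_Int[of "A \<union> B" C] dist by simp
  ultimately have "dense (A \<union> B \<union> C)"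
    using A(1) B(1) C(1) edges by (simp add: dense_def)
  with A B show False using not_abc by blast
qed

section \<open>Laman's theorem\<close>

text \<open>
  The induction is on the number of non-isolated vertices: all graphs live on the vertex set \<open>UNIV\<close>, so
  removing a vertex means removing its edges.
\<close>

theorem laman_sparse_imp_stress_free:
  fixes E :: "'v::finite set set"
  assumes "simple_graph UNIV E" "laman_sparse E"
  shows "\<exists>x :: (real ^ 2) ^ 'v. stress_free x E"
  using assms
proof (induction "card (\<Union>E)" arbitrary: E rule: less_induct)
  case less
  note sg = \<open>simple_graph UNIV E\<close> and sp = \<open>laman_sparse E\<close>
  show ?case
  proof (cases "E = {}")
    case True
    then show ?thesis by (simp add: stress_free_def)
  next
    case False
    then obtain v where v: "v \<in> \<Union>E" "card {e \<in> E. v \<in> e} \<le> 3"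
      by (rule laman_sparse_low_degree_vertex[OF sg sp])
    let ?D = "{e \<in> E. v \<in> e}"
    define F where "F = E - ?D"
    have F: "\<And>e. e \<in> F \<Longrightarrow> v \<notin> e" "F \<subseteq> E" "E = F \<union> ?D"
      by (auto simp: F_def)
    have IH: "\<exists>x :: (real ^ 2) ^ 'v. stress_free x E'"
      if "simple_graph UNIV E'" "laman_sparse E'" "\<Union>E' \<subseteq> \<Union>E - {v}" for E'
    proof (rule less.hyps)
      show "card (\<Union>E') < card (\<Union>E)"
        using that(3) v(1) by (intro psubset_card_mono finite psubsetI) blast+
    qed (use that in auto)
    show ?thesis
    proof (cases "card ?D \<le> 2")
      case True
      obtain x :: "(real ^ 2) ^ 'v" where "stress_free x F"
        using IH[of F] F simple_graph_subset[OF sg F(2)] laman_sparse_subset[OF sp F(2)] by blast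
      then obtain y :: "(real ^ 2) ^ 'v" where "stress_free y F" "general_position y"
        by (rule stress_free_general_position)
      then show ?thesis
        using stress_free_zero_extension[OF sg _ True] unfolding F_def by blast
    next
      case False
      with v(2) have "card ?D = 3" by simp
      then obtain e f g where efg: "?D = {e, f, g}" "e \<noteq> f" "e \<noteq> g" "f \<noteq> g"
        by (auto simp: card_3_iff)
      have "\<exists>a. e = {v, a} \<and> a \<noteq> v" if "e \<in> ?D" for e
        using that simple_graph_edgeE[OF sg, of e] by (auto simp: insert_commute)
      from this[of e] this[of f] this[of g] efg(1)
      obtain a b c where abc: "e = {v, a}" "a \<noteq> v" "f = {v, b}" "b \<noteq> v" "g = {v, c}" "c \<noteq> v"
        by blast
      have D: "?D = {{v, a}, {v, b}, {v, c}}" and dist: "distinct [v, a, b, c]"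
        using efg abc by auto
      have "laman_sparse (F \<union> {{v, a}, {v, b}, {v, c}})"
        using sp F(3) unfolding D by simp
      from laman_sparse_reverse_one_extension[OF simple_graph_subset[OF sg F(2)] F(1) dist this]
      obtain a' b' c' where abc': "{a', b', c'} = {a, b, c}" "distinct [a', b', c']"
        "{a', b'} \<notin> F" "laman_sparse (insert {a', b'} F)" by blast
      have "v \<notin> {a', b', c'}"
        unfolding abc'(1) using dist by auto
      then have dist': "distinct [v, a', b', c']"
        using abc'(2) by auto
      have "?D = (\<lambda>u. {v, u}) ` {a', b', c'}"
        unfolding D abc'(1) by auto
      then have D': "E = F \<union> {{v, a'}, {v, b'}, {v, c'}}"
        using F(3) by simp
      have "simple_graph UNIV (insert {a', b'} F)"
        using simple_graph_subset[OF sg F(2)] abc'(2) by (auto simp: simple_graph_def)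
      moreover have "\<Union>(insert {a', b'} F) \<subseteq> \<Union>E - {v}"
        using F(1) dist' by (subst D') auto
      ultimately obtain x :: "(real ^ 2) ^ 'v" where "stress_free x (insert {a', b'} F)"
        using IH abc'(4) by blast
      then obtain y :: "(real ^ 2) ^ 'v" where "stress_free y (insert {a', b'} F)" "general_position y"
        by (rule stress_free_general_position)
      then obtain z :: "(real ^ 2) ^ 'v" where "stress_free z E"
        using stress_free_one_extension[OF dist' F(1) abc'(3)] D' by metis
      then show ?thesis ..
    qed
  qed
qed

text \<open>
  The rank never exceeds the number of edges, so a placement with independent rows is regular.
  Conversely, Laman's theorem provides a placement whose rank is the number of edges, and regularity
  gives \<open>p\<close> at least that rank.
\<close>

theorem minimally_infinitesimally_rigid_plane_iff_laman:
  fixes p :: "(real ^ 2) ^ 'v::finite"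
  assumes fw: "bar_joint_framework E p" and n: "CARD('v) \<ge> 2"
  shows "minimally_infinitesimally_rigid norm E p \<longleftrightarrow>
    laman_graph UNIV E \<and> regular_placement norm E p"
proof
  assume min: "minimally_infinitesimally_rigid norm E p"
  note sf = minimally_rigid_imp_stress_free[OF fw min]
  have sg: "simple_graph UNIV E"
    using fw by (simp add: bar_joint_framework_def)
  have dim: "dim (rigidity_row p ` E) = card E" and card: "card E + 3 = 2 * CARD('v)"
    using min minimally_infinitesimally_rigid_plane_iff[OF fw n] by auto
  have "int (card F) \<le> 2 * int (card W) - 3" if "subgraph W F UNIV E" "card W \<ge> 2" for W F
  proof (cases "F = {}")
    case True
    then show ?thesis using that(2) by simp
  next
    case False
    have "stress_free p F"
      using that(1) by (intro stress_free_subset[OF sf]) (simp add: subgraph_def)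
    then have "card F + 3 \<le> 2 * card W"
      using that(1) False by (intro stress_free_plane_card_le[of W F p]) (auto simp: subgraph_def)
    then show ?thesis by linarith
  qed
  moreover have "int (card E) = 2 * int (CARD('v)) - 3"
    using card by linarith
  ultimately have "laman_graph UNIV E"
    unfolding laman_graph_def using sg by blast
  moreover have "regular_placement norm E p"
    unfolding regular_placement_def well_positioned_norm_iff
    using fw by (auto simp: rigidity_rank_norm dim dim_rigidity_row_le)
  ultimately show "laman_graph UNIV E \<and> regular_placement norm E p" ..
next
  assume *: "laman_graph UNIV E \<and> regular_placement norm E p"
  then have sg: "simple_graph UNIV E" and card: "int (card E) = 2 * int (CARD('v)) - 3"
    by (auto simp: laman_graph_def)
  have "laman_sparse E"
    unfolding laman_sparse_def
  proof (intro allI impI)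
    fix W :: "'v set" assume W: "2 \<le> card W"
    have "subgraph W {e \<in> E. e \<subseteq> W} UNIV E"
      using sg by (auto simp: subgraph_def simple_graph_def)
    with * W have "int (card {e \<in> E. e \<subseteq> W}) \<le> 2 * int (card W) - 3"
      unfolding laman_graph_def by blast
    then show "card {e \<in> E. e \<subseteq> W} + 3 \<le> 2 * card W" by linarith
  qed
  then obtain x :: "(real ^ 2) ^ 'v" where x: "stress_free x E"
    using laman_sparse_imp_stress_free[OF sg] by blast
  have "x $ v \<noteq> x $ w" if "{v, w} \<in> E" for v w
  proof -
    have "card {v, w} = 2" using sg that unfolding simple_graph_def by blast
    then have "v \<noteq> w" by auto
    then show ?thesis by (rule stress_free_edge_neq[OF x that])
  qed
  with sg have fwx: "bar_joint_framework E x"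
    by (simp add: bar_joint_framework_def)
  then have "rigidity_rank norm E x \<le> rigidity_rank norm E p"
    using * by (simp add: regular_placement_def well_positioned_norm_iff)
  then have "card E \<le> dim (rigidity_row p ` E)"
    by (simp add: rigidity_rank_norm fw fwx stress_free_imp_dim[OF x])
  with dim_rigidity_row_le[of p E] have "dim (rigidity_row p ` E) = card E"
    by simp
  moreover have "card E + 3 = 2 * CARD('v)"
    using card by linarith
  ultimately show "minimally_infinitesimally_rigid norm E p"
    by (simp add: minimally_infinitesimally_rigid_plane_iff[OF fw n])
qed

theorem theorem5p4:
  fixes E :: "'v::finite set set"
    and p :: "((real ^ 2) \<times> real) ^ 'v"
  defines "E\<^sub>1 \<equiv> monochrome_edges fst E p"
    and "E\<^sub>2 \<equiv> monochrome_edges snd E p"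
    and "p\<^sub>1 \<equiv> projected_placement fst p"
    and "p\<^sub>2 \<equiv> projected_placement snd p"
  assumes "well_positioned cyl_norm E p"
  shows "(minimally_infinitesimally_rigid cyl_norm E p \<longleftrightarrow>
            minimally_infinitesimally_rigid norm E\<^sub>1 p\<^sub>1 \<and>
            minimally_infinitesimally_rigid norm E\<^sub>2 p\<^sub>2) \<and>
         (CARD('v) \<ge> 2 \<longrightarrow>
           (minimally_infinitesimally_rigid norm E\<^sub>1 p\<^sub>1 \<and>
            minimally_infinitesimally_rigid norm E\<^sub>2 p\<^sub>2 \<longleftrightarrow>
            laman_graph (UNIV :: 'v set) E\<^sub>1 \<and> tree_graph (UNIV :: 'v set) E\<^sub>2 \<and>
            regular_placement norm E\<^sub>1 p\<^sub>1))"
  using minimally_infinitesimally_rigid_cyl_norm_iff[OF assms(5)]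
    minimally_infinitesimally_rigid_plane_iff_laman[OF bar_joint_framework_projected(1)[OF assms(5)]]
    minimally_infinitesimally_rigid_line_iff_tree[OF bar_joint_framework_projected(2)[OF assms(5)]]
  unfolding E\<^sub>1_def E\<^sub>2_def p\<^sub>1_def p\<^sub>2_def by blast

end
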